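(* Let $n\ge 3$, let $a\in\mathbb{C}$ with $|a|=2$, and let $N\in C_2(\mathbb{C}^n)$ be the $n\times n$ matrix whose $(1,n)$ entry is $a$ and whose other entries are all $0$. Then the Harnack part of $N$ in $C_2(\mathbb{C}^n)$ is the set of all matrices of $C_2(\mathbb{C}^n)$ of the form $$T=\begin{pmatrix}0&0&a\\0&B&0\\0&0&0\end{pmatrix}$$ (block form with respect to $\mathbb{C}^n=\mathbb{C}\oplus\mathbb{C}^{n-2}\oplus\mathbb{C}$), with $B\in C_2(\mathbb{C}^{n-2})$ such that $w(B)<1$.
   Context: For $m\ge1$, $C_2(\mathbb{C}^m)$ is the set of $m\times m$ complex matrices $T$ whose numerical radius $w(T)=\sup\{|\langle Tx,x\rangle|:\|x\|=1\}$ is at most $1$. For $T\in C_2(\mathbb{C}^m)$ and $z$ in the open unit disc $\mathbb{D}$, put $K_z^2(T)=(I-\overline{z}T)^{-1}+(I-zT^* )^{-1}$. For $T_0,T_1\in C_2(\mathbb{C}^m)$, $T_1$ is Harnack dominated by $T_0$ if there is a constant $c\ge 1$ with $K_z^2(T_1)\le c^2K_z^2(T_0)$ for all $z\in\mathbb{D}$; they are Harnack equivalent if each is Harnack dominated by the other. The Harnack part of $T$ is its equivalence class under Harnack equivalence. *)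

theory Defs
  imports
    Complex_Main
    "Jordan_Normal_Form.Matrix"
    "Jordan_Normal_Form.Gauss_Jordan_Elimination"
    "Jordan_Normal_Form.Schur_Decomposition"
begin

definition vec_norm2 :: "complex vec \<Rightarrow> real" where
  "vec_norm2 x = sqrt (Re (x \<bullet>c x))"

(* Only meaningful for square matrices of positive size: otherwise the supremum is over
   the empty set. *)
definition numerical_radius :: "complex mat \<Rightarrow> real" where
  "numerical_radius T =
     (SUP x \<in> {x \<in> carrier_vec (dim_row T). vec_norm2 x = 1}. cmod ((T *\<^sub>v x) \<bullet>c x))"

definition C2 :: "nat \<Rightarrow> complex mat set" where
  "C2 m = {T \<in> carrier_mat m m. numerical_radius T \<le> 1}"

(* The order on complex numbers is the one in which 0 \<le> z means that z is real and
   nonnegative. *)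
definition positive_mat :: "nat \<Rightarrow> complex mat \<Rightarrow> bool" where
  "positive_mat m A \<longleftrightarrow>
     A \<in> carrier_mat m m \<and> (\<forall>x \<in> carrier_vec m. 0 \<le> (A *\<^sub>v x) \<bullet>c x)"

(* Not the library's (\<le>) on matrices, which is entrywise. *)
definition loewner_le :: "nat \<Rightarrow> complex mat \<Rightarrow> complex mat \<Rightarrow> bool" where
  "loewner_le m A B \<longleftrightarrow>
     A \<in> carrier_mat m m \<and> B \<in> carrier_mat m m \<and> positive_mat m (B - A)"

(* Unspecified for singular matrices. The matrices inverted below are invertible, since
   the spectral radius of T is at most its numerical radius. *)
definition inv_mat :: "complex mat \<Rightarrow> complex mat" where
  "inv_mat A = the (mat_inverse A)"

definition K2 :: "nat \<Rightarrow> complex \<Rightarrow> complex mat \<Rightarrow> complex mat" where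
  "K2 m z T = inv_mat (1\<^sub>m m - cnj z \<cdot>\<^sub>m T) + inv_mat (1\<^sub>m m - z \<cdot>\<^sub>m mat_adjoint T)"

(* harnack_dominated m T1 T0: T1 is dominated by T0. *)
definition harnack_dominated :: "nat \<Rightarrow> complex mat \<Rightarrow> complex mat \<Rightarrow> bool" where
  "harnack_dominated m T1 T0 \<longleftrightarrow>
     (\<exists>c::real. c \<ge> 1 \<and>
        (\<forall>z. cmod z < 1 \<longrightarrow>
           loewner_le m (K2 m z T1) (complex_of_real (c\<^sup>2) \<cdot>\<^sub>m K2 m z T0)))"

definition harnack_equivalence :: "nat \<Rightarrow> (complex mat \<times> complex mat) set" where
  "harnack_equivalence m =
     {(S, T). S \<in> C2 m \<and> T \<in> C2 m \<and> harnack_dominated m S T \<and> harnack_dominated m T S}"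

definition harnack_part :: "nat \<Rightarrow> complex mat \<Rightarrow> complex mat set" where
  "harnack_part m T = harnack_equivalence m `` {T}"

(* Indices start at 0, so this is the entry in position (1, n) of the usual numbering. *)
definition corner_mat :: "nat \<Rightarrow> complex \<Rightarrow> complex mat" where
  "corner_mat n a = mat n n (\<lambda>(i, j). if i = 0 \<and> j = n - 1 then a else 0)"

(* The block matrix ((0,0,a), (0,B,0), (0,0,0)) for the decomposition 1 + (n - 2) + 1. *)
definition corner_block_mat :: "nat \<Rightarrow> complex \<Rightarrow> complex mat \<Rightarrow> complex mat" where
  "corner_block_mat n a B = mat n n (\<lambda>(i, j).
     if i = 0 \<and> j = n - 1 then a
     else if 0 < i \<and> i < n - 1 \<and> 0 < j \<and> j < n - 1 then B $$ (i - 1, j - 1)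
     else 0)"

end

theory Submission
  imports Defs "Jordan_Normal_Form.Spectral_Radius"
begin

text \<open>
  Write \<open>w\<close> for the conjugate of \<open>z\<close> and \<open>a = 2u\<close>. If \<open>y - w T y = x\<close>, then
  \<open>\<langle>K x, x\<rangle> = 2 Re \<langle>y, x\<rangle>\<close> for the kernel \<open>K\<close> of \<open>T\<close> at \<open>z\<close>, so Harnack domination
  compares \<open>Re \<langle>y, x\<rangle>\<close> for the solutions of two such equations with the same \<open>x\<close>.

  Let \<open>T\<close> be dominated by \<open>N\<close>. For \<open>x = e\<^sub>n - u \<zeta> e\<^sub>1\<close> and \<open>w = r \<zeta>\<close> with \<open>\<bar>\<zeta>\<bar> = 1\<close>, the kernel of \<open>N\<close>
  gives \<open>2 (1 - r)\<close>. Expanding the resolvent of \<open>T\<close> in a Neumann series and averaging over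
  roots of unity \<open>\<zeta>\<close> leaves only \<open>2 - r Re (cnj u \<langle>T e\<^sub>n, e\<^sub>1\<rangle>)\<close>, whence, as \<open>r\<close> tends to 1,
  \<open>Re (cnj u \<langle>T e\<^sub>n, e\<^sub>1\<rangle>) \<ge> 2\<close>. Averaging \<open>\<parallel>y\<parallel>\<^sup>2 - Re (\<zeta> \<langle>T y, y\<rangle>) \<ge> 0\<close> over the vectors
  \<open>y = e\<^sub>n + u \<zeta> e\<^sub>1\<close> with \<open>\<zeta>\<close> a fourth root of unity, one sees that all of them are minimisers;
  the four resulting linear equations force the block form of \<open>T\<close>.

  If moreover \<open>N\<close> is dominated by \<open>T\<close>, then \<open>\<parallel>y - w B y\<parallel>\<^sup>2\<close> and \<open>Re \<langle>y, y - w B y\<rangle>\<close> are comparable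
  uniformly in \<open>w\<close>. For a unit vector \<open>y\<close> with \<open>\<bar>\<langle>B y, y\<rangle>\<bar>\<close> within \<open>t\<^sup>2\<close> of 1, the first is of order
  \<open>t\<^sup>2\<close> at radius \<open>1 - t\<^sup>2\<close>, hence also at radius \<open>1 - t\<close>, where the second is at least \<open>t\<close>; this is
  absurd for small \<open>t\<close>. Conversely, when the numerical radius of \<open>B\<close>
  is less than 1, both quantities are comparable to \<open>\<parallel>y\<parallel>\<^sup>2\<close>.
\<close>

section \<open>Numerical radius and the kernel\<close>

definition sqn :: "complex vec \<Rightarrow> real" where
  "sqn x = Re (x \<bullet>c x)"

lemma cip_eq_sum: "x \<bullet>c y = (\<Sum>i<dim_vec y. x $ i * cnj (y $ i))"
  by (simp add: scalar_prod_def atLeast0LessThan)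

lemma cip_linear:
  "dim_vec x = dim_vec z \<Longrightarrow> dim_vec y = dim_vec z \<Longrightarrow> (x + y) \<bullet>c z = x \<bullet>c z + y \<bullet>c z"
  "dim_vec x = dim_vec z \<Longrightarrow> dim_vec y = dim_vec z \<Longrightarrow> (x - y) \<bullet>c z = x \<bullet>c z - y \<bullet>c z"
  "dim_vec x = dim_vec z \<Longrightarrow> (k \<cdot>\<^sub>v x) \<bullet>c z = k * (x \<bullet>c z)"
  "dim_vec x = dim_vec z \<Longrightarrow> dim_vec y = dim_vec z \<Longrightarrow> z \<bullet>c (x + y) = z \<bullet>c x + z \<bullet>c y"
  "dim_vec x = dim_vec z \<Longrightarrow> dim_vec y = dim_vec z \<Longrightarrow> z \<bullet>c (x - y) = z \<bullet>c x - z \<bullet>c y"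
  "dim_vec x = dim_vec z \<Longrightarrow> z \<bullet>c (k \<cdot>\<^sub>v x) = cnj k * (z \<bullet>c x)"
  by (simp_all add: cip_eq_sum algebra_simps sum.distrib sum_subtractf sum_distrib_left del: scalar_prod_smult_left scalar_prod_smult_right)

lemma cip_swap: "dim_vec x = dim_vec y \<Longrightarrow> cnj (x \<bullet>c y) = y \<bullet>c x"
  by (simp add: cip_eq_sum mult.commute)

lemma cip_self: "x \<bullet>c x = complex_of_real (sqn x)"
  by (auto simp: sqn_def cip_eq_sum complex_eq_iff)

lemma sqn_eq_sum: "sqn x = (\<Sum>i<dim_vec x. (cmod (x $ i))\<^sup>2)"
  unfolding sqn_def cip_eq_sum
  by (simp add: cmod_power2 flip: power2_eq_square)

lemma sqn_nonneg [simp]: "0 \<le> sqn x"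
  by (simp add: sqn_eq_sum sum_nonneg)

lemma sqn_eq_0_iff: "x \<in> carrier_vec n \<Longrightarrow> sqn x = 0 \<longleftrightarrow> x = 0\<^sub>v n"
  using conjugate_square_eq_0_vec[of x n] by (simp add: cip_self)

lemma sqn_smult: "sqn (k \<cdot>\<^sub>v x) = (cmod k)\<^sup>2 * sqn x"
  by (simp add: sqn_eq_sum norm_mult power_mult_distrib sum_distrib_left)

lemma sqn_add:
  "dim_vec x = dim_vec y \<Longrightarrow> sqn (x + y) = sqn x + sqn y + 2 * Re (x \<bullet>c y)"
  using arg_cong[OF cip_swap[of x y], of Re]
  by (simp add: sqn_def cip_linear)

lemma sqn_diff:
  "dim_vec x = dim_vec y \<Longrightarrow> sqn (x - y) = sqn x + sqn y - 2 * Re (x \<bullet>c y)"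
  using arg_cong[OF cip_swap[of x y], of Re]
  by (simp add: sqn_def cip_linear)

lemma sqn_diff_le: "dim_vec x = dim_vec y \<Longrightarrow> sqn (x - y) \<le> 2 * sqn x + 2 * sqn y"
  using sqn_add[of x y] sqn_diff[of x y] sqn_nonneg[of "x + y"] by linarith

lemma sqn_add_le: "dim_vec x = dim_vec y \<Longrightarrow> sqn (x + y) \<le> 2 * sqn x + 2 * sqn y"
  using sqn_add[of x y] sqn_diff[of x y] sqn_nonneg[of "x - y"] by linarith

lemma cmod_index_le: "i < dim_vec x \<Longrightarrow> cmod (x $ i) \<le> sqrt (sqn x)"
  unfolding sqn_eq_sum
  by (intro real_le_rsqrt member_le_sum[of _ _ "\<lambda>i. (cmod (x $ i))\<^sup>2"]) auto

text \<open>Young's inequality with a free weight: expand the squared norm of \<open>s x - y\<close>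
  and divide by \<open>s\<close>.\<close>

lemma two_Re_cip_le:
  assumes "dim_vec x = dim_vec y" "0 < s"
  shows "2 * Re (x \<bullet>c y) \<le> s * sqn x + sqn y / s"
proof -
  have "0 \<le> sqn (complex_of_real s \<cdot>\<^sub>v x - y)" by simp
  also have "\<dots> = s\<^sup>2 * sqn x + sqn y - 2 * s * Re (x \<bullet>c y)"
    using assms by (subst sqn_diff) (simp_all add: sqn_smult cip_linear)
  finally have "2 * Re (x \<bullet>c y) * s \<le> (s * sqn x + sqn y / s) * s"
    using assms by (simp add: algebra_simps power2_eq_square)
  then show ?thesis using assms by (simp add: mult_le_cancel_right)
qed

lemma cmod_mult_vec_index_le:
  assumes A: "A \<in> carrier_mat n n" and x: "x \<in> carrier_vec n" and i: "i < n"
  shows "cmod ((A *\<^sub>v x) $ i) \<le> (\<Sum>j<n. cmod (A $$ (i, j))) * sqrt (sqn x)"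
proof -
  have "cmod ((A *\<^sub>v x) $ i) = cmod (\<Sum>j<n. A $$ (i, j) * x $ j)"
    using A x i by (simp add: scalar_prod_def atLeast0LessThan)
  also have "\<dots> \<le> (\<Sum>j<n. cmod (A $$ (i, j)) * cmod (x $ j))"
    using norm_sum[of "\<lambda>j. A $$ (i, j) * x $ j" "{..<n}"] by (simp add: norm_mult)
  also have "\<dots> \<le> (\<Sum>j<n. cmod (A $$ (i, j)) * sqrt (sqn x))"
    using x by (intro sum_mono mult_left_mono cmod_index_le) auto
  finally show ?thesis by (simp add: sum_distrib_right)
qed

text \<open>A crude estimate by the sum of all entry moduli. It bounds the set whose supremum is the
  numerical radius, and later turns growth of the entries of powers into growth of their
  forms.\<close>

lemma cmod_cip_mult_le:
  assumes A: "A \<in> carrier_mat n n" and x: "x \<in> carrier_vec n" and y: "y \<in> carrier_vec n"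
  shows "cmod ((A *\<^sub>v x) \<bullet>c y) \<le> (\<Sum>i<n. \<Sum>j<n. cmod (A $$ (i, j))) * (sqrt (sqn x) * sqrt (sqn y))"
proof -
  have "cmod ((A *\<^sub>v x) \<bullet>c y) \<le> (\<Sum>i<n. cmod ((A *\<^sub>v x) $ i) * cmod (y $ i))"
    using y norm_sum[of "\<lambda>i. (A *\<^sub>v x) $ i * cnj (y $ i)" "{..<n}"]
    by (simp add: cip_eq_sum norm_mult del: index_mult_mat_vec)
  also have "\<dots> \<le> (\<Sum>i<n. ((\<Sum>j<n. cmod (A $$ (i, j))) * sqrt (sqn x)) * sqrt (sqn y))"
    using cmod_mult_vec_index_le[OF A x] y
    by (intro sum_mono mult_mono cmod_index_le) (auto intro!: mult_nonneg_nonneg sum_nonneg simp del: index_mult_mat_vec)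
  finally show ?thesis by (simp add: sum_distrib_right mult.assoc)
qed

lemma ex_sqn_mult_le:
  assumes A: "(A :: complex mat) \<in> carrier_mat n n"
  shows "\<exists>K\<ge>0. \<forall>x\<in>carrier_vec n. sqn (A *\<^sub>v x) \<le> K * sqn x"
proof (intro exI conjI ballI)
  show "0 \<le> (\<Sum>i<n. (\<Sum>j<n. cmod (A $$ (i, j)))\<^sup>2)" by (simp add: sum_nonneg)
  fix x :: "complex vec" assume x: "x \<in> carrier_vec n"
  have "sqn (A *\<^sub>v x) = (\<Sum>i<n. (cmod ((A *\<^sub>v x) $ i))\<^sup>2)"
    using A by (simp add: sqn_eq_sum)
  also have "\<dots> \<le> (\<Sum>i<n. ((\<Sum>j<n. cmod (A $$ (i, j))) * sqrt (sqn x))\<^sup>2)"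
    using cmod_mult_vec_index_le[OF A x] by (intro sum_mono power_mono) auto
  also have "\<dots> = (\<Sum>i<n. (\<Sum>j<n. cmod (A $$ (i, j)))\<^sup>2) * sqn x"
    unfolding power_mult_distrib real_sqrt_pow2[OF sqn_nonneg] by (rule sum_distrib_right[symmetric])
  finally show "sqn (A *\<^sub>v x) \<le> (\<Sum>i<n. (\<Sum>j<n. cmod (A $$ (i, j)))\<^sup>2) * sqn x" .
qed

section \<open>The numerical radius as a bound for the quadratic form\<close>

lemma vec_norm2_eq: "vec_norm2 x = sqrt (sqn x)"
  by (simp add: vec_norm2_def sqn_def)

text \<open>Both sides are homogeneous of degree 2 in \<open>x\<close>, so a nonzero
  \<open>x\<close> may be scaled to norm 1, where the value lies below the supremum.\<close>

lemma cmod_cip_le_numerical_radius: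
  assumes A: "A \<in> carrier_mat n n" and x: "x \<in> carrier_vec n"
  shows "cmod ((A *\<^sub>v x) \<bullet>c x) \<le> numerical_radius A * sqn x"
proof (cases "sqn x = 0")
  case True
  then show ?thesis using A x sqn_eq_0_iff[OF x] by (auto simp: cip_eq_sum)
next
  case False
  then have pos: "sqn x > 0" using sqn_nonneg[of x] by linarith
  let ?k = "complex_of_real (1 / sqrt (sqn x))"
  let ?S = "(\<lambda>x. cmod ((A *\<^sub>v x) \<bullet>c x)) ` {x \<in> carrier_vec (dim_row A). vec_norm2 x = 1}"
  \<comment> \<open>A real supremum is an upper bound only of a set that is bounded above; the entry
    estimate supplies this.\<close>
  have "bdd_above ?S"
    using A cmod_cip_mult_le[OF A]
    by (intro bdd_aboveI[of _ "\<Sum>i<n. \<Sum>j<n. cmod (A $$ (i, j))"]) (fastforce simp: vec_norm2_eq)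
  moreover have "sqn (?k \<cdot>\<^sub>v x) = 1"
    using pos unfolding sqn_smult by (simp add: norm_divide power_divide)
  ultimately have "cmod ((A *\<^sub>v (?k \<cdot>\<^sub>v x)) \<bullet>c (?k \<cdot>\<^sub>v x)) \<le> numerical_radius A"
    unfolding numerical_radius_def using A x by (intro cSUP_upper) (auto simp: vec_norm2_eq)
  also have "(A *\<^sub>v (?k \<cdot>\<^sub>v x)) \<bullet>c (?k \<cdot>\<^sub>v x) = ?k * ?k * ((A *\<^sub>v x) \<bullet>c x)"
    using A x by (simp add: mult_mat_vec[OF A x] cip_linear)
  finally have "cmod ((A *\<^sub>v x) \<bullet>c x) / sqn x \<le> numerical_radius A"
    using pos by (simp add: norm_mult norm_divide)
  then show ?thesis using pos by (simp add: field_simps)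
qed

text \<open>A supremum over the empty set is unspecified; since \<open>n\<close> is positive, the
  first unit vector shows that the unit sphere is nonempty.\<close>

lemma numerical_radius_le:
  assumes A: "A \<in> carrier_mat n n" and n: "0 < n"
    and le: "\<And>x. x \<in> carrier_vec n \<Longrightarrow> sqn x = 1 \<Longrightarrow> cmod ((A *\<^sub>v x) \<bullet>c x) \<le> k"
  shows "numerical_radius A \<le> k"
proof -
  have "sqn (unit_vec n 0) = 1"
    using n unfolding sqn_eq_sum by (subst sum.remove[of _ 0]) (auto simp: unit_vec_def)
  then have "unit_vec n 0 \<in> {x \<in> carrier_vec (dim_row A). vec_norm2 x = 1}"
    using A by (simp add: vec_norm2_eq)
  then show ?thesis
    unfolding numerical_radius_def using A le by (intro cSUP_least) (blast, auto simp: vec_norm2_eq)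
qed

lemma C2_carrier: "T \<in> C2 n \<Longrightarrow> T \<in> carrier_mat n n"
  by (simp add: C2_def)

lemma C2_cmod_cip_le:
  assumes T: "T \<in> C2 n" and x: "x \<in> carrier_vec n"
  shows "cmod ((T *\<^sub>v x) \<bullet>c x) \<le> sqn x"
proof -
  have "numerical_radius T * sqn x \<le> 1 * sqn x"
    using T by (intro mult_right_mono) (auto simp: C2_def)
  then show ?thesis
    using cmod_cip_le_numerical_radius[OF C2_carrier[OF T] x] by simp
qed

lemma C2_Re_cip_le:
  assumes T: "T \<in> C2 n" and x: "x \<in> carrier_vec n" 
  shows "Re (w * ((T *\<^sub>v x) \<bullet>c x)) \<le> cmod w * sqn x"
proof -
  have "Re (w * ((T *\<^sub>v x) \<bullet>c x)) \<le> cmod (w * ((T *\<^sub>v x) \<bullet>c x))"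
    by (rule complex_Re_le_cmod)
  also have "\<dots> \<le> cmod w * sqn x"
    unfolding norm_mult by (intro mult_left_mono C2_cmod_cip_le[OF T x]) simp
  finally show ?thesis .
qed

section \<open>Resolvents and the quadratic form of the kernel\<close>

lemma inv_mat_inverse:
  assumes A: "A \<in> carrier_mat n n"
    and ker: "\<And>v. v \<in> carrier_vec n \<Longrightarrow> A *\<^sub>v v = 0\<^sub>v n \<Longrightarrow> v = 0\<^sub>v n"
  shows "inv_mat A \<in> carrier_mat n n" "A * inv_mat A = 1\<^sub>m n" "inv_mat A * A = 1\<^sub>m n"
proof -
  have "det A \<noteq> 0"
    using det_0_iff_vec_prod_zero[OF A] ker by auto
  then have "mat_inverse A \<noteq> None"
    using mat_inverse(1)[OF A, of "()"] det_non_zero_imp_unit[OF A, of "()"] by auto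
  then obtain B where "mat_inverse A = Some B" by auto
  with mat_inverse(2)[OF A this] 
  show "inv_mat A \<in> carrier_mat n n" "A * inv_mat A = 1\<^sub>m n" "inv_mat A * A = 1\<^sub>m n"
    by (auto simp: inv_mat_def)
qed

lemma smult_mat_mult_vec:
  fixes k :: complex
  assumes A: "A \<in> carrier_mat n n" and v: "v \<in> carrier_vec n"
  shows "(k \<cdot>\<^sub>m A) *\<^sub>v v = k \<cdot>\<^sub>v (A *\<^sub>v v)"
  using A v by (intro eq_vecI) (auto simp: scalar_prod_def sum_distrib_left mult.assoc)

lemma one_minus_smult_mult_vec:
  fixes w :: complex
  assumes A: "A \<in> carrier_mat n n" and v: "v \<in> carrier_vec n"
  shows "(1\<^sub>m n - w \<cdot>\<^sub>m A) *\<^sub>v v = v - w \<cdot>\<^sub>v (A *\<^sub>v v)"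
  using A v by (simp add: minus_mult_distrib_mat_vec[of _ n n] smult_mat_mult_vec)

lemma mat_adjoint_carrier: "(A :: complex mat) \<in> carrier_mat n n \<Longrightarrow> mat_adjoint A \<in> carrier_mat n n"
  by (intro carrier_matI) (simp_all add: mat_adjoint_def)

lemma cip_mat_adjoint:
  assumes A: "(A :: complex mat) \<in> carrier_mat n n" and x: "x \<in> carrier_vec n" and y: "y \<in> carrier_vec n"
  shows "(mat_adjoint A *\<^sub>v x) \<bullet>c y = x \<bullet>c (A *\<^sub>v y)"
proof -
  have "(mat_adjoint A *\<^sub>v x) $ i = (\<Sum>j<n. cnj (A $$ (j, i)) * x $ j)" if "i < n" for i
    using A x that by (simp add: mat_adjoint_def scalar_prod_def atLeast0LessThan)
  moreover have "(A *\<^sub>v y) $ j = (\<Sum>i<n. A $$ (j, i) * y $ i)" if "j < n" for j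
    using A y that by (simp add: scalar_prod_def atLeast0LessThan)
  ultimately have eqs: "(mat_adjoint A *\<^sub>v x) \<bullet>c y = (\<Sum>i<n. \<Sum>j<n. cnj (A $$ (j, i)) * x $ j * cnj (y $ i))"
    "x \<bullet>c (A *\<^sub>v y) = (\<Sum>j<n. \<Sum>i<n. cnj (A $$ (j, i)) * x $ j * cnj (y $ i))"
    using A x y by (simp_all add: cip_eq_sum sum_distrib_right sum_distrib_left ac_simps del: index_mult_mat_vec)
  show ?thesis unfolding eqs by (rule sum.swap)
qed

text \<open>Coercivity of \<open>I - w T\<close> in the open disc, the source of its invertibility
  and of all norm bounds on solutions. It follows from the bound on the form of \<open>T\<close>
  after conjugating one inner product.\<close>

lemma sqn_le_Re_cip_resolvent:
  assumes T: "T \<in> C2 n" and y: "y \<in> carrier_vec n"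
  shows "(1 - cmod w) * sqn y \<le> Re (y \<bullet>c (y - w \<cdot>\<^sub>v (T *\<^sub>v y)))"
    and "Re (y \<bullet>c (y - w \<cdot>\<^sub>v (T *\<^sub>v y))) = sqn y - Re (w * ((T *\<^sub>v y) \<bullet>c y))"
proof -
  have Tc: "T \<in> carrier_mat n n" using T by (rule C2_carrier)
  have "cnj (w * ((T *\<^sub>v y) \<bullet>c y)) = cnj w * (y \<bullet>c (T *\<^sub>v y))"
    using cip_swap[of "T *\<^sub>v y" y] Tc y by simp
  from arg_cong[OF this, of Re]
  show eq: "Re (y \<bullet>c (y - w \<cdot>\<^sub>v (T *\<^sub>v y))) = sqn y - Re (w * ((T *\<^sub>v y) \<bullet>c y))"
    using Tc y by (simp add: cip_linear sqn_def)
  show "(1 - cmod w) * sqn y \<le> Re (y \<bullet>c (y - w \<cdot>\<^sub>v (T *\<^sub>v y)))"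
    unfolding eq using C2_Re_cip_le[OF T y, of w] by (simp add: algebra_simps)
qed

text \<open>The two inverses in the kernel are adjoint to each other, so their forms at
  \<open>x\<close> are complex conjugates and add up to twice a real part.\<close>

lemma K2_cip:
  assumes T: "T \<in> C2 n" and z: "cmod z < 1" and x: "x \<in> carrier_vec n"
  obtains y where "y \<in> carrier_vec n" "y - cnj z \<cdot>\<^sub>v (T *\<^sub>v y) = x"
    "K2 n z T \<in> carrier_mat n n"
    "(K2 n z T *\<^sub>v x) \<bullet>c x = complex_of_real (2 * Re (y \<bullet>c x))"
proof -
  have Tc: "T \<in> carrier_mat n n" using T by (rule C2_carrier)
  have Ta: "mat_adjoint T \<in> carrier_mat n n" using Tc by (rule mat_adjoint_carrier)
  let ?A = "1\<^sub>m n - cnj z \<cdot>\<^sub>m T" and ?B = "1\<^sub>m n - z \<cdot>\<^sub>m mat_adjoint T"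
  have A: "?A \<in> carrier_mat n n" and B: "?B \<in> carrier_mat n n" using Tc Ta by auto
  have adj: "(?B *\<^sub>v v) \<bullet>c u = v \<bullet>c (?A *\<^sub>v u)" if "v \<in> carrier_vec n" "u \<in> carrier_vec n" for u v
    using that Tc Ta cip_mat_adjoint[OF Tc that]
    by (simp add: one_minus_smult_mult_vec[OF Tc] one_minus_smult_mult_vec[OF Ta] cip_linear)
  \<comment> \<open>The assumption is vanishing of the form, not of \<open>?A *\<^sub>v v\<close>:
    through \<open>adj\<close> the same argument then proves \<open>?B\<close> injective
    too.\<close>
  have ker: "v = 0\<^sub>v n" if v: "v \<in> carrier_vec n" and "v \<bullet>c (?A *\<^sub>v v) = 0" for v
  proof -
    have "(1 - cmod (cnj z)) * sqn v \<le> 0"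
      using that sqn_le_Re_cip_resolvent(1)[OF T v, of "cnj z"]
      by (simp add: one_minus_smult_mult_vec[OF Tc])
    then have "sqn v = 0" using z sqn_nonneg[of v] by (simp add: mult_le_0_iff)
    then show ?thesis using v by (simp add: sqn_eq_0_iff)
  qed
  have kerA: "v = 0\<^sub>v n" if "v \<in> carrier_vec n" "?A *\<^sub>v v = 0\<^sub>v n" for v
    using that by (intro ker) auto
  have kerB: "v = 0\<^sub>v n" if "v \<in> carrier_vec n" "?B *\<^sub>v v = 0\<^sub>v n" for v
    using that adj[of v v] by (intro ker) auto
  note iA = inv_mat_inverse[OF A kerA] and iB = inv_mat_inverse[OF B kerB]
  define y where "y = inv_mat ?A *\<^sub>v x"
  define y' where "y' = inv_mat ?B *\<^sub>v x"
  have yc: "y \<in> carrier_vec n" and y'c: "y' \<in> carrier_vec n"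
    using iA(1) iB(1) x by (auto simp: y_def y'_def)
  have Ay: "?A *\<^sub>v y = x"
    unfolding y_def using assoc_mult_mat_vec[OF A iA(1) x] iA(2) x by simp
  have By: "?B *\<^sub>v y' = x"
    unfolding y'_def using assoc_mult_mat_vec[OF B iB(1) x] iB(2) x by simp
  have "y' \<bullet>c x = x \<bullet>c y" using adj[OF y'c yc] Ay By by simp
  then have sw: "y' \<bullet>c x = cnj (y \<bullet>c x)" using cip_swap[of y x] yc x by simp
  have K: "K2 n z T \<in> carrier_mat n n" unfolding K2_def using iA(1) iB(1) by auto
  have "K2 n z T *\<^sub>v x = y + y'"
    unfolding K2_def y_def y'_def using iA(1) iB(1) x by (intro add_mult_distrib_mat_vec)
  then have "(K2 n z T *\<^sub>v x) \<bullet>c x = complex_of_real (2 * Re (y \<bullet>c x))"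
    using yc y'c x by (simp add: cip_linear sw complex_eq_iff)
  moreover have "y - cnj z \<cdot>\<^sub>v (T *\<^sub>v y) = x"
    using Ay one_minus_smult_mult_vec[OF Tc yc] by simp
  ultimately show ?thesis using that yc K by blast
qed

text \<open>The difference of two solutions solves the homogeneous equation, and coercivity makes it
  0.\<close>

lemma resolvent_unique:
  assumes T: "T \<in> C2 n" and w: "cmod w < 1" and y: "y \<in> carrier_vec n" and v: "v \<in> carrier_vec n"
    and eq: "y - w \<cdot>\<^sub>v (T *\<^sub>v y) = v - w \<cdot>\<^sub>v (T *\<^sub>v v)"
  shows "y = v"
proof -
  have Tc: "T \<in> carrier_mat n n" using T by (rule C2_carrier)
  have "(y - v) - w \<cdot>\<^sub>v (T *\<^sub>v (y - v)) = 0\<^sub>v n"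
  proof (rule eq_vecI)
    fix i assume "i < dim_vec (0\<^sub>v n :: complex vec)"
    then show "((y - v) - w \<cdot>\<^sub>v (T *\<^sub>v (y - v))) $ i = 0\<^sub>v n $ i"
      using Tc y v arg_cong[OF eq, of "\<lambda>u. u $ i"]
      by (simp add: mult_minus_distrib_mat_vec[OF Tc] algebra_simps)
  qed (use Tc y v in auto)
  then have "(1 - cmod w) * sqn (y - v) \<le> 0"
    using sqn_le_Re_cip_resolvent(1)[OF T, of "y - v" w] y v by simp
  then have "sqn (y - v) = 0" using w sqn_nonneg[of "y - v"] by (simp add: mult_le_0_iff)
  then have "y - v = 0\<^sub>v n" using y v sqn_eq_0_iff[of "y - v" n] by simp
  then have "(y - v) $ i = 0" if "i < n" for i using that by simp
  then show ?thesis using y v by (intro eq_vecI) auto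
qed

text \<open>Since each resolvent equation has exactly one solution, the vector \<open>x\<close> at
  which the kernels are tested can be given through the solutions \<open>y\<close> and
  \<open>v\<close>; no inverse remains. Here \<open>w\<close> is \<open>cnj z\<close>, which runs
  through the same disc.\<close>

lemma harnack_dominated_iff:
  assumes S: "S \<in> C2 n" and T: "T \<in> C2 n"
  shows "harnack_dominated n S T \<longleftrightarrow>
    (\<exists>c\<ge>1. \<forall>w y v. cmod w < 1 \<longrightarrow> y \<in> carrier_vec n \<longrightarrow> v \<in> carrier_vec n \<longrightarrow>
       y - w \<cdot>\<^sub>v (S *\<^sub>v y) = v - w \<cdot>\<^sub>v (T *\<^sub>v v) \<longrightarrow>
       Re (y \<bullet>c (y - w \<cdot>\<^sub>v (S *\<^sub>v y))) \<le> c\<^sup>2 * Re (v \<bullet>c (v - w \<cdot>\<^sub>v (T *\<^sub>v v))))"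
    (is "_ \<longleftrightarrow> (\<exists>c\<ge>1. ?P c)")
proof -
  have "(\<forall>z. cmod z < 1 \<longrightarrow> loewner_le n (K2 n z S) (complex_of_real (c\<^sup>2) \<cdot>\<^sub>m K2 n z T)) \<longleftrightarrow> ?P c"
    (is "?L \<longleftrightarrow> _") for c
  proof -
    \<comment> \<open>Uniqueness identifies the solutions delivered by \<open>K2_cip\<close> with
      the given \<open>y\<close> and \<open>v\<close>.\<close>
    have key: "(((complex_of_real (c\<^sup>2) \<cdot>\<^sub>m K2 n z T - K2 n z S) *\<^sub>v x) \<bullet>c x)
        = complex_of_real (2 * (c\<^sup>2 * Re (v \<bullet>c x) - Re (y \<bullet>c x)))"
      if z: "cmod z < 1" and x: "x \<in> carrier_vec n" and y: "y \<in> carrier_vec n" "y - cnj z \<cdot>\<^sub>v (S *\<^sub>v y) = x"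
        and v: "v \<in> carrier_vec n" "v - cnj z \<cdot>\<^sub>v (T *\<^sub>v v) = x" for z x y v
    proof -
      obtain y' where y': "y' \<in> carrier_vec n" "y' - cnj z \<cdot>\<^sub>v (S *\<^sub>v y') = x" "K2 n z S \<in> carrier_mat n n"
        "(K2 n z S *\<^sub>v x) \<bullet>c x = complex_of_real (2 * Re (y' \<bullet>c x))"
        by (rule K2_cip[OF S z x])
      obtain v' where v': "v' \<in> carrier_vec n" "v' - cnj z \<cdot>\<^sub>v (T *\<^sub>v v') = x" "K2 n z T \<in> carrier_mat n n"
        "(K2 n z T *\<^sub>v x) \<bullet>c x = complex_of_real (2 * Re (v' \<bullet>c x))"
        by (rule K2_cip[OF T z x])
      have "y' = y" "v' = v"
        using y y' v v' z resolvent_unique[OF S, of "cnj z" y' y] resolvent_unique[OF T, of "cnj z" v' v] by auto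
      moreover have "(complex_of_real (c\<^sup>2) \<cdot>\<^sub>m K2 n z T - K2 n z S) *\<^sub>v x =
          complex_of_real (c\<^sup>2) \<cdot>\<^sub>v (K2 n z T *\<^sub>v x) - K2 n z S *\<^sub>v x"
        using y'(3) v'(3) x by (simp add: minus_mult_distrib_mat_vec[of _ n n] smult_mat_mult_vec)
      ultimately show ?thesis
        using y' v' x by (simp add: cip_linear algebra_simps)
    qed
    show ?thesis
    proof
      assume L: ?L
      show "?P c"
      proof (intro allI impI)
        fix w y v
        assume w: "cmod w < 1" and y: "y \<in> carrier_vec n" and v: "v \<in> carrier_vec n"
          and eq: "y - w \<cdot>\<^sub>v (S *\<^sub>v y) = v - w \<cdot>\<^sub>v (T *\<^sub>v v)"
        let ?x = "v - w \<cdot>\<^sub>v (T *\<^sub>v v)"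
        have x: "?x \<in> carrier_vec n" using v C2_carrier[OF T] by auto
        have "0 \<le> ((complex_of_real (c\<^sup>2) \<cdot>\<^sub>m K2 n (cnj w) T - K2 n (cnj w) S) *\<^sub>v ?x) \<bullet>c ?x"
          using L w x by (auto simp: loewner_le_def positive_mat_def)
        then show "Re (y \<bullet>c (y - w \<cdot>\<^sub>v (S *\<^sub>v y))) \<le> c\<^sup>2 * Re (v \<bullet>c ?x)"
          using key[of "cnj w" ?x y v] w x y v eq by (simp add: less_eq_complex_def)
      qed
    next
      assume P: "?P c"
      show ?L
      proof (intro allI impI)
        fix z assume z: "cmod z < 1"
        have K: "K2 n z S \<in> carrier_mat n n" "K2 n z T \<in> carrier_mat n n"
          by (rule K2_cip[OF S z zero_carrier_vec], assumption) (rule K2_cip[OF T z zero_carrier_vec], assumption)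
        have "0 \<le> ((complex_of_real (c\<^sup>2) \<cdot>\<^sub>m K2 n z T - K2 n z S) *\<^sub>v x) \<bullet>c x" if x: "x \<in> carrier_vec n" for x
        proof -
          obtain y where y: "y \<in> carrier_vec n" "y - cnj z \<cdot>\<^sub>v (S *\<^sub>v y) = x"
            by (rule K2_cip[OF S z x]) blast
          obtain v where v: "v \<in> carrier_vec n" "v - cnj z \<cdot>\<^sub>v (T *\<^sub>v v) = x"
            by (rule K2_cip[OF T z x]) blast
          have "Re (y \<bullet>c x) \<le> c\<^sup>2 * Re (v \<bullet>c x)"
            using P[rule_format, of "cnj z" y v] z y v by simp
          then show ?thesis
            using key[OF z x y v] by (simp add: less_eq_complex_def)
        qed
        then show "loewner_le n (K2 n z S) (complex_of_real (c\<^sup>2) \<cdot>\<^sub>m K2 n z T)"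
          using K by (auto simp: loewner_le_def positive_mat_def)
      qed
    qed
  qed
  then show ?thesis by (simp add: harnack_dominated_def)
qed

section \<open>Corner block matrices\<close>

definition middle_vec :: "nat \<Rightarrow> complex vec \<Rightarrow> complex vec" where
  "middle_vec n x = vec (n - 2) (\<lambda>i. x $ (Suc i))"

definition embed_vec :: "nat \<Rightarrow> complex vec \<Rightarrow> complex vec" where
  "embed_vec n y = vec n (\<lambda>i. if 0 < i \<and> i < n - 1 then y $ (i - 1) else 0)"

lemma middle_vec_carrier [simp]: "middle_vec n x \<in> carrier_vec (n - 2)"
  and embed_vec_carrier [simp]: "embed_vec n y \<in> carrier_vec n"
  and dim_middle_vec [simp]: "dim_vec (middle_vec n x) = n - 2"
  and dim_embed_vec [simp]: "dim_vec (embed_vec n x) = n"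
  by (simp_all add: middle_vec_def embed_vec_def)

lemma middle_embed_vec: "y \<in> carrier_vec (n - 2) \<Longrightarrow> middle_vec n (embed_vec n y) = y"
  by (intro eq_vecI) (auto simp: middle_vec_def embed_vec_def)

lemma embed_vec_ends: "3 \<le> n \<Longrightarrow> embed_vec n y $ 0 = 0" "3 \<le> n \<Longrightarrow> embed_vec n y $ (n - 1) = 0"
  by (auto simp: embed_vec_def)

lemma sum_split_ends:
  fixes f :: "nat \<Rightarrow> 'a :: comm_monoid_add"
  assumes "3 \<le> n"
  shows "(\<Sum>i<n. f i) = f 0 + (\<Sum>i<n - 2. f (Suc i)) + f (n - 1)"
proof -
  define m where "m = n - 2"
  then have "n = Suc (Suc m)" using assms by simp
  moreover have "(\<Sum>i<Suc (Suc m). f i) = f 0 + (\<Sum>i<m. f (Suc i)) + f (Suc m)"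
    by (subst sum.lessThan_Suc, subst sum.lessThan_Suc_shift) simp
  ultimately show ?thesis by simp
qed

lemma cip_split_ends:
  assumes "3 \<le> n" "y \<in> carrier_vec n"
  shows "x \<bullet>c y = x $ 0 * cnj (y $ 0) + middle_vec n x \<bullet>c middle_vec n y + x $ (n - 1) * cnj (y $ (n - 1))"
  using assms by (simp add: cip_eq_sum sum_split_ends middle_vec_def)

lemma sqn_split_ends:
  assumes "3 \<le> n" "x \<in> carrier_vec n"
  shows "sqn x = (cmod (x $ 0))\<^sup>2 + sqn (middle_vec n x) + (cmod (x $ (n - 1)))\<^sup>2"
  using assms by (simp add: sqn_eq_sum sum_split_ends middle_vec_def)

lemma corner_block_mat_carrier [simp]: "corner_block_mat n a B \<in> carrier_mat n n"
  by (simp add: corner_block_mat_def)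

lemma corner_mat_eq_block: "corner_mat n a = corner_block_mat n a (0\<^sub>m (n - 2) (n - 2))"
  by (intro eq_matI) (auto simp: corner_mat_def corner_block_mat_def)

lemma corner_block_mult_vec:
  assumes n: "3 \<le> n" and B: "B \<in> carrier_mat (n - 2) (n - 2)" and x: "x \<in> carrier_vec n"
  shows "(corner_block_mat n a B *\<^sub>v x) $ 0 = a * x $ (n - 1)"
    and "(corner_block_mat n a B *\<^sub>v x) $ (n - 1) = 0"
    and "middle_vec n (corner_block_mat n a B *\<^sub>v x) = B *\<^sub>v middle_vec n x"
proof -
  have row: "(corner_block_mat n a B *\<^sub>v x) $ i = (\<Sum>j<n. corner_block_mat n a B $$ (i, j) * x $ j)"
    if "i < n" for i
    using that x by (simp add: corner_block_mat_def scalar_prod_def atLeast0LessThan)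
  have entries: "corner_block_mat n a B $$ (0, 0) = 0" "\<And>j. j < n - 2 \<Longrightarrow> corner_block_mat n a B $$ (0, Suc j) = 0"
    "corner_block_mat n a B $$ (0, n - 1) = a" "\<And>j. j < n \<Longrightarrow> corner_block_mat n a B $$ (n - 1, j) = 0"
    using n by (auto simp: corner_block_mat_def)
  show "(corner_block_mat n a B *\<^sub>v x) $ 0 = a * x $ (n - 1)"
    "(corner_block_mat n a B *\<^sub>v x) $ (n - 1) = 0"
    using n entries row[of 0] row[of "n - 1"] by (simp_all add: sum_split_ends[OF n] del: index_mult_mat_vec)
  show "middle_vec n (corner_block_mat n a B *\<^sub>v x) = B *\<^sub>v middle_vec n x"
  proof (rule eq_vecI)
    fix i assume "i < dim_vec (B *\<^sub>v middle_vec n x)"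
    then have i: "i < n - 2" using B by simp
    then have "middle_vec n (corner_block_mat n a B *\<^sub>v x) $ i = (\<Sum>j<n. corner_block_mat n a B $$ (Suc i, j) * x $ j)"
      unfolding middle_vec_def using row[of "Suc i"] by simp
    also have "\<dots> = (\<Sum>j<n - 2. B $$ (i, j) * x $ Suc j)"
      using n i by (auto simp: sum_split_ends corner_block_mat_def intro!: sum.cong)
    also have "\<dots> = (B *\<^sub>v middle_vec n x) $ i"
      using B i by (simp add: scalar_prod_def middle_vec_def atLeast0LessThan)
    finally show "middle_vec n (corner_block_mat n a B *\<^sub>v x) $ i = (B *\<^sub>v middle_vec n x) $ i" .
  qed (use B in simp)
qed

text \<open>The inequality between arithmetic and geometric means, with \<open>cmod b\<close> at
  most 2 as the exact threshold for the two end coordinates.\<close>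

lemma corner_quadratic_nonneg:
  assumes "cmod b \<le> 2"
  shows "cmod (b * q * cnj p) \<le> (cmod p)\<^sup>2 + (cmod q)\<^sup>2"
proof -
  have "cmod (b * q * cnj p) \<le> 2 * (cmod q * cmod p)"
    unfolding norm_mult complex_mod_cnj mult.assoc using assms by (intro mult_right_mono) auto
  also have "\<dots> \<le> (cmod p)\<^sup>2 + (cmod q)\<^sup>2"
    using zero_le_power2[of "cmod p - cmod q"] by (simp add: power2_diff algebra_simps)
  finally show ?thesis .
qed

text \<open>The form is the sum of a corner term in the end coordinates and the form of
  \<open>B\<close> in the middle ones, and the squared norm splits accordingly.\<close>

lemma corner_block_mat_C2:
  assumes n: "3 \<le> n" and a: "cmod a = 2" and B: "B \<in> C2 (n - 2)"
  shows "corner_block_mat n a B \<in> C2 n"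
proof -
  have Bc: "B \<in> carrier_mat (n - 2) (n - 2)" using B by (rule C2_carrier)
  have "numerical_radius (corner_block_mat n a B) \<le> 1"
  proof (rule numerical_radius_le)
    fix x assume x: "x \<in> carrier_vec n" and "sqn x = 1"
    let ?m = "middle_vec n x"
    have "(corner_block_mat n a B *\<^sub>v x) \<bullet>c x = a * x $ (n - 1) * cnj (x $ 0) + (B *\<^sub>v ?m) \<bullet>c ?m"
      using cip_split_ends[OF n x] by (simp add: corner_block_mult_vec[OF n Bc x] del: index_mult_mat_vec One_nat_def)
    then have "cmod ((corner_block_mat n a B *\<^sub>v x) \<bullet>c x) \<le>
        cmod (a * x $ (n - 1) * cnj (x $ 0)) + cmod ((B *\<^sub>v ?m) \<bullet>c ?m)"
      by (simp add: norm_triangle_ineq)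
    also have "\<dots> \<le> ((cmod (x $ 0))\<^sup>2 + (cmod (x $ (n - 1)))\<^sup>2) + sqn ?m"
      using a by (intro add_mono corner_quadratic_nonneg C2_cmod_cip_le[OF B]) auto
    also have "\<dots> = sqn x" using sqn_split_ends[OF n x] by simp
    finally show "cmod ((corner_block_mat n a B *\<^sub>v x) \<bullet>c x) \<le> 1" using \<open>sqn x = 1\<close> by simp
  qed (use n in auto)
  then show ?thesis by (simp add: C2_def)
qed

section \<open>Domination between corner block matrices\<close>

lemma zero_mat_C2:
  assumes "0 < m"
  shows "0\<^sub>m m m \<in> C2 m" "numerical_radius (0\<^sub>m m m) < 1"
proof -
  have "numerical_radius (0\<^sub>m m m) \<le> 0"
    using assms by (intro numerical_radius_le[of _ m]) (auto simp: cip_eq_sum scalar_prod_def)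
  then show "0\<^sub>m m m \<in> C2 m" "numerical_radius (0\<^sub>m m m) < 1"
    by (auto simp: C2_def)
qed

text \<open>The resolvent equation decouples. The end coordinates contribute equally for both
  matrices; on the middle block both forms are comparable to the squared norm of the right-hand
  side.\<close>

lemma corner_block_mat_dominated:
  assumes n: "3 \<le> n" and a: "cmod a = 2"
    and B: "B \<in> C2 (n - 2)" "numerical_radius B < 1"
    and D: "D \<in> C2 (n - 2)" "numerical_radius D < 1"
  shows "harnack_dominated n (corner_block_mat n a B) (corner_block_mat n a D)"
proof -
  let ?S = "corner_block_mat n a B" and ?T = "corner_block_mat n a D"
  have Bc: "B \<in> carrier_mat (n - 2) (n - 2)" and Dc: "D \<in> carrier_mat (n - 2) (n - 2)"
    using B D by (auto intro: C2_carrier)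
  \<comment> \<open>In contrast to the factor \<open>1 - cmod w\<close>, this constant does not
    degenerate as \<open>w\<close> approaches the unit circle.\<close>
  have coercive: "(1 - numerical_radius A) * sqn y \<le> Re (y \<bullet>c (y - w \<cdot>\<^sub>v (A *\<^sub>v y)))"
    if A: "A \<in> C2 (n - 2)" and y: "y \<in> carrier_vec (n - 2)" and w: "cmod w < 1" for A y w
  proof -
    have "Re (w * ((A *\<^sub>v y) \<bullet>c y)) \<le> cmod (w * ((A *\<^sub>v y) \<bullet>c y))" by (rule complex_Re_le_cmod)
    also have "\<dots> \<le> 1 * cmod ((A *\<^sub>v y) \<bullet>c y)"
      unfolding norm_mult using w by (intro mult_right_mono) auto
    also have "\<dots> \<le> numerical_radius A * sqn y"
      using cmod_cip_le_numerical_radius[OF C2_carrier[OF A] y] by simp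
    finally show ?thesis
      using sqn_le_Re_cip_resolvent(2)[OF A y, of w] by (simp add: algebra_simps)
  qed
  obtain K where K: "0 \<le> K" "\<And>y. y \<in> carrier_vec (n - 2) \<Longrightarrow> sqn (D *\<^sub>v y) \<le> K * sqn y"
    using ex_sqn_mult_le[OF Dc] by blast
  define \<beta> where "\<beta> = 1 - numerical_radius B"
  define \<delta> where "\<delta> = 1 - numerical_radius D"
  define C where "C = (2 + 2 * K) / (\<beta> * \<delta>)"
  have pos: "\<beta> > 0" "\<delta> > 0" and C: "C \<ge> 0"
    using B D K by (auto simp: \<beta>_def \<delta>_def C_def)
  have split: "Re (y \<bullet>c x) = Re (y $ 0 * cnj (y $ 0 - w * (a * y $ (n - 1))) + y $ (n - 1) * cnj (y $ (n - 1)))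
        + Re (middle_vec n y \<bullet>c middle_vec n x)"
      "middle_vec n x = middle_vec n y - w \<cdot>\<^sub>v (A *\<^sub>v middle_vec n y)"
      "x $ (n - 1) = y $ (n - 1)" "x $ 0 = y $ 0 - w * (a * y $ (n - 1))"
    if y: "y \<in> carrier_vec n" and A: "A \<in> carrier_mat (n - 2) (n - 2)"
      and x: "x = y - w \<cdot>\<^sub>v (corner_block_mat n a A *\<^sub>v y)" for x y w A
  proof -
    have dim: "dim_vec (corner_block_mat n a A *\<^sub>v y) = n" by (simp add: corner_block_mat_def)
    have xc: "x \<in> carrier_vec n" using x y dim by (intro carrier_vecI) simp
    show 1: "x $ (n - 1) = y $ (n - 1)" "x $ 0 = y $ 0 - w * (a * y $ (n - 1))"
      using y n dim unfolding x by (simp_all add: corner_block_mult_vec[OF n A y] del: index_mult_mat_vec dim_mult_mat_vec One_nat_def)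
    have "middle_vec n x = middle_vec n y - w \<cdot>\<^sub>v middle_vec n (corner_block_mat n a A *\<^sub>v y)"
      using y dim unfolding x by (intro eq_vecI) (auto simp: middle_vec_def simp del: index_mult_mat_vec dim_mult_mat_vec)
    then show "middle_vec n x = middle_vec n y - w \<cdot>\<^sub>v (A *\<^sub>v middle_vec n y)"
      by (simp add: corner_block_mult_vec[OF n A y])
    show "Re (y \<bullet>c x) = Re (y $ 0 * cnj (y $ 0 - w * (a * y $ (n - 1))) + y $ (n - 1) * cnj (y $ (n - 1)))
        + Re (middle_vec n y \<bullet>c middle_vec n x)"
      unfolding cip_split_ends[OF n xc] 1 by simp
  qed
  have "Re (y \<bullet>c (y - w \<cdot>\<^sub>v (?S *\<^sub>v y))) \<le> (sqrt (1 + C))\<^sup>2 * Re (v \<bullet>c (v - w \<cdot>\<^sub>v (?T *\<^sub>v v)))"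
    if w: "cmod w < 1" and y: "y \<in> carrier_vec n" and v: "v \<in> carrier_vec n"
      and eq: "y - w \<cdot>\<^sub>v (?S *\<^sub>v y) = v - w \<cdot>\<^sub>v (?T *\<^sub>v v)" for w y v
  proof -
    let ?y = "middle_vec n y" and ?v = "middle_vec n v"
    define x where "x = y - w \<cdot>\<^sub>v (?S *\<^sub>v y)"
    let ?x = "middle_vec n x"
    have x': "x = v - w \<cdot>\<^sub>v (?T *\<^sub>v v)" using eq by (simp add: x_def)
    note sy = split[OF y Bc x_def] and sv = split[OF v Dc x']
    \<comment> \<open>The end equations are triangular and carry the same \<open>a\<close>, so a
      common right-hand side determines the same end coordinates.\<close>
    have ends: "y $ (n - 1) = v $ (n - 1)" "y $ 0 = v $ 0"
      using sy(3,4) sv(3,4) by auto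
    \<comment> \<open>The common contribution of the end coordinates to both forms.\<close>
    define P where "P = Re (v $ 0 * cnj (v $ 0 - w * (a * v $ (n - 1))) + v $ (n - 1) * cnj (v $ (n - 1)))"
    have P: "0 \<le> P"
    proof -
      have "Re (w * a * v $ (n - 1) * cnj (v $ 0)) \<le> cmod (w * a * v $ (n - 1) * cnj (v $ 0))"
        by (rule complex_Re_le_cmod)
      also have "\<dots> \<le> (cmod (v $ 0))\<^sup>2 + (cmod (v $ (n - 1)))\<^sup>2"
        using w a by (intro corner_quadratic_nonneg) (auto simp: norm_mult)
      finally have "0 \<le> (cmod (v $ 0))\<^sup>2 + (cmod (v $ (n - 1)))\<^sup>2 - Re (w * a * v $ (n - 1) * cnj (v $ 0))"
        by simp
      also have "\<dots> = P"
        unfolding P_def cmod_power2 by (simp add: algebra_simps power2_eq_square)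
      finally show ?thesis .
    qed
    have "\<beta> * sqn ?y \<le> Re (?y \<bullet>c ?x)"
      using coercive[OF B(1) middle_vec_carrier w, of y] by (simp add: sy(2) \<beta>_def)
    \<comment> \<open>With the weight \<beta>, coercivity absorbs the term in \<open>sqn ?y\<close>
      into one of the two copies of the left side.\<close>
    moreover have "2 * Re (?y \<bullet>c ?x) \<le> \<beta> * sqn ?y + sqn ?x / \<beta>"
      using pos by (intro two_Re_cip_le) auto
    ultimately have 1: "Re (?y \<bullet>c ?x) \<le> sqn ?x / \<beta>" by linarith
    have 2: "\<delta> * sqn ?v \<le> Re (?v \<bullet>c ?x)"
      using coercive[OF D(1) middle_vec_carrier w, of v] by (simp add: sv(2) \<delta>_def)
    have "sqn ?x \<le> 2 * sqn ?v + 2 * sqn (w \<cdot>\<^sub>v (D *\<^sub>v ?v))"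
      unfolding sv(2) using Dc by (intro sqn_diff_le) auto
    also have "sqn (w \<cdot>\<^sub>v (D *\<^sub>v ?v)) \<le> 1 * sqn (D *\<^sub>v ?v)"
      unfolding sqn_smult using w by (intro mult_right_mono) (auto simp: power_le_one)
    also have "sqn (D *\<^sub>v ?v) \<le> K * sqn ?v" by (intro K) simp
    finally have "sqn ?x \<le> (2 + 2 * K) * sqn ?v" by (simp add: algebra_simps)
    also have "\<dots> \<le> (2 + 2 * K) * (Re (?v \<bullet>c ?x) / \<delta>)"
      using 2 pos K by (intro mult_left_mono) (auto simp: field_simps)
    finally have "Re (?y \<bullet>c ?x) \<le> (2 + 2 * K) * (Re (?v \<bullet>c ?x) / \<delta>) / \<beta>"
      using 1 pos by (meson divide_right_mono less_imp_le order_trans)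
    then have 3: "Re (?y \<bullet>c ?x) \<le> C * Re (?v \<bullet>c ?x)" by (simp add: C_def mult.commute)
    have "0 \<le> \<delta> * sqn ?v" using pos by simp
    with 2 have "0 \<le> Re (?v \<bullet>c ?x)" by linarith
    moreover have "0 \<le> C * P" using P C by simp
    \<comment> \<open>Nonnegativity of \<open>P\<close> and of the middle form lets the single
      factor \<open>1 + C\<close> serve both summands.\<close>
    ultimately have "P + Re (?y \<bullet>c ?x) \<le> (1 + C) * (P + Re (?v \<bullet>c ?x))"
      using 3 by (simp add: algebra_simps)
    then have "Re (y \<bullet>c x) \<le> (1 + C) * Re (v \<bullet>c x)"
      unfolding sy(1) sv(1) ends P_def .
    then show ?thesis using C eq by (simp add: x_def)
  qed
  moreover have "1 \<le> sqrt (1 + C)" using C by simp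
  ultimately show ?thesis
    unfolding harnack_dominated_iff[OF corner_block_mat_C2[OF n a B(1)] corner_block_mat_C2[OF n a D(1)]]
    by blast
qed

lemma corner_block_imp_C2:
  assumes n: "3 \<le> n" and B: "B \<in> carrier_mat (n - 2) (n - 2)" and T: "corner_block_mat n a B \<in> C2 n"
  shows "B \<in> C2 (n - 2)"
proof -
  have "numerical_radius B \<le> 1"
  proof (rule numerical_radius_le[OF B])
    fix y assume y: "y \<in> carrier_vec (n - 2)" and "sqn y = 1"
    let ?e = "embed_vec n y"
    have "(corner_block_mat n a B *\<^sub>v ?e) \<bullet>c ?e = (B *\<^sub>v y) \<bullet>c y"
      using cip_split_ends[OF n embed_vec_carrier] n
      by (simp add: corner_block_mult_vec[OF n B] middle_embed_vec[OF y] embed_vec_ends del: index_mult_mat_vec One_nat_def)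
    moreover have "sqn ?e = sqn y"
      using n by (simp add: sqn_split_ends[OF n] middle_embed_vec[OF y] embed_vec_ends del: One_nat_def)
    ultimately show "cmod ((B *\<^sub>v y) \<bullet>c y) \<le> 1"
      using C2_cmod_cip_le[OF T, of ?e] \<open>sqn y = 1\<close> by simp
  qed (use n in simp)
  with B show ?thesis by (simp add: C2_def)
qed

section \<open>Matrices dominated by the corner matrix\<close>

text \<open>Pairing \<open>T v\<close> with an eigenvector \<open>v\<close> turns the bound on the
  form into a bound on the eigenvalue.\<close>

lemma C2_spectral_radius_le:
  assumes T: "T \<in> C2 n" and n: "0 < n"
  shows "spectral_radius T \<le> 1"
proof -
  have Tc: "T \<in> carrier_mat n n" using T by (rule C2_carrier)
  obtain k v where k: "spectral_radius T = cmod k" and v: "v \<in> carrier_vec n" "v \<noteq> 0\<^sub>v n" "T *\<^sub>v v = k \<cdot>\<^sub>v v"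
    using spectral_radius_mem_max(1)[OF Tc n] Tc
    by (auto simp: spectrum_def eigenvalue_def eigenvector_def)
  have "cmod ((T *\<^sub>v v) \<bullet>c v) = cmod k * sqn v"
    unfolding v(3) using v(1) by (simp add: cip_linear cip_self norm_mult)
  then have "cmod k * sqn v \<le> 1 * sqn v" using C2_cmod_cip_le[OF T v(1)] by simp
  moreover have "0 < sqn v" using v sqn_eq_0_iff[OF v(1)] sqn_nonneg[of v] by linarith
  ultimately show ?thesis unfolding k by (simp add: mult_le_cancel_right)
qed

text \<open>With \<open>s\<close> the \<open>d\<close>-th root of \<open>r\<close>, the expression
  is the \<open>d\<close>-th power of \<open>k s^k\<close>, which tends to 0.\<close>

lemma power_times_poly_tendsto_0:
  fixes r :: real
  assumes "0 \<le> r" "r < 1" "0 < d"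
  shows "(\<lambda>k. r ^ k * real k ^ d) \<longlonglongrightarrow> 0"
proof -
  define s where "s = root d r"
  have s: "0 \<le> s" "s < 1" "s ^ d = r"
    using assms by (auto simp: s_def real_root_pow_pos2)
  have "(\<lambda>k. (real k * s ^ k) ^ d) \<longlonglongrightarrow> 0 ^ d"
    using s by (intro tendsto_power powser_times_n_limit_0) auto
  moreover have "(real k * s ^ k) ^ d = r ^ k * real k ^ d" for k
    unfolding s(3)[symmetric] by (simp add: power_mult_distrib power_mult[symmetric] mult.commute)
  ultimately show ?thesis using assms by (simp add: power_0_left)
qed

text \<open>Spectral radius at most 1 gives polynomial growth of the powers by Jordan normal form,
  and the geometric factor beats it. The bound is uniform in \<open>x\<close> and \<open>y\<close>,
  so it applies to solutions that change with \<open>z\<close>. By \<open>2 \<le> n\<close> the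
  degree \<open>n - 1\<close> is positive.\<close>

lemma C2_powers_decay:
  assumes T: "T \<in> C2 n" and n: "2 \<le> n" and r: "0 \<le> r" "r < 1"
  shows "\<exists>g. g \<longlonglongrightarrow> 0 \<and> (\<forall>k. \<forall>x\<in>carrier_vec n. \<forall>y\<in>carrier_vec n.
    r ^ k * cmod ((T ^\<^sub>m k *\<^sub>v x) \<bullet>c y) \<le> g k * (sqrt (sqn x) * sqrt (sqn y)))"
proof -
  have Tc: "T \<in> carrier_mat n n" using T by (rule C2_carrier)
  obtain c1 c2 where "\<forall>k. norm_bound (T ^\<^sub>m k) (c1 + c2 * of_nat k ^ (n - 1))"
    using spectral_radius_jnf_norm_bound_le_1_upper_triangular[OF Tc C2_spectral_radius_le[OF T]] n by auto
  then have entry: "cmod ((T ^\<^sub>m k) $$ (i, j)) \<le> c1 + c2 * real k ^ (n - 1)" if "i < n" "j < n" for i j k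
    using that pow_carrier_mat[OF Tc, of k] Tc by (auto simp: norm_bound_def)
  define g where "g = (\<lambda>k. real n * real n * (c1 * r ^ k + c2 * (r ^ k * real k ^ (n - 1))))"
  have "g \<longlonglongrightarrow> real n * real n * (c1 * 0 + c2 * 0)"
    unfolding g_def using r n by (intro tendsto_intros power_times_poly_tendsto_0 LIMSEQ_power_zero) auto
  then have "g \<longlonglongrightarrow> 0" by simp
  moreover have "r ^ k * cmod ((T ^\<^sub>m k *\<^sub>v x) \<bullet>c y) \<le> g k * (sqrt (sqn x) * sqrt (sqn y))"
    if x: "x \<in> carrier_vec n" and y: "y \<in> carrier_vec n" for k x y
  proof -
    let ?b = "c1 + c2 * real k ^ (n - 1)"
    have "cmod ((T ^\<^sub>m k *\<^sub>v x) \<bullet>c y) \<le> (\<Sum>i<n. \<Sum>j<n. cmod ((T ^\<^sub>m k) $$ (i, j))) * (sqrt (sqn x) * sqrt (sqn y))"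
      by (rule cmod_cip_mult_le[OF pow_carrier_mat[OF Tc] x y])
    also have "\<dots> \<le> (\<Sum>i<n. \<Sum>j<n. ?b) * (sqrt (sqn x) * sqrt (sqn y))"
      by (intro mult_right_mono sum_mono entry) auto
    finally have "r ^ k * cmod ((T ^\<^sub>m k *\<^sub>v x) \<bullet>c y) \<le> r ^ k * ((\<Sum>i<n. \<Sum>j<n. ?b) * (sqrt (sqn x) * sqrt (sqn y)))"
      using r by (intro mult_left_mono) auto
    also have "\<dots> = g k * (sqrt (sqn x) * sqrt (sqn y))"
      by (simp add: g_def algebra_simps)
    finally show ?thesis .
  qed
  ultimately show ?thesis by blast
qed

section \<open>Averaging over roots of unity and the Neumann series\<close>

lemma sum_powers_root_of_unity:
  assumes "0 < k" "k < M"
  shows "(\<Sum>j<M. (cis (2 * pi / real M) ^ j) ^ k) = 0"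
proof -
  let ?\<omega> = "cis (2 * pi / real M)"
  have inj: "inj_on (\<lambda>k. cis (2 * pi * real k / real M)) {..<M}"
    using assms bij_betw_roots_unity[of M] by (simp add: bij_betw_def)
  have pow: "?\<omega> ^ k = cis (2 * pi * real k / real M)"
    by (simp add: DeMoivre mult.commute)
  have "?\<omega> ^ k \<noteq> 1"
    using inj_onD[OF inj, of k 0] assms unfolding pow by auto
  moreover have "(?\<omega> ^ k) ^ M = 1"
    using assms using cis_multiple_2pi[of "real k"] by (simp add: DeMoivre mult.commute mult.left_commute)
  ultimately have "(\<Sum>j<M. (?\<omega> ^ k) ^ j) = 0"
    by (simp add: geometric_sum)
  then show ?thesis by (simp add: power_mult[symmetric] mult.commute)
qed

text \<open>As \<open>\<gamma> 0 = 0\<close>, only the powers of \<open>z\<close> from 0 to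
  \<open>L\<close> occur. There are \<open>Suc L\<close> nodes, so no positive power aliases to a
  constant; the constant terms are \<open>\<alpha> 0\<close> and, by \<open>cnj z * z = 1\<close>,
  \<open>\<gamma> 1\<close>.\<close>

lemma average_trig_poly:
  fixes \<alpha> \<beta> \<gamma> :: "nat \<Rightarrow> complex"
  assumes \<gamma>0: "\<gamma> 0 = 0" and L: "2 \<le> L"
  shows "(\<Sum>j<Suc L. let z = cis (2 * pi / real (Suc L)) ^ j in \<Sum>m<L. z ^ m * (\<alpha> m + z * \<beta> m + cnj z * \<gamma> m))
    = of_nat (Suc L) * (\<alpha> 0 + \<gamma> 1)"
proof -
  define \<zeta> where "\<zeta> = (\<lambda>j. cis (2 * pi / real (Suc L)) ^ j)"
  have S: "(\<Sum>j<Suc L. \<zeta> j ^ k) = 0" if "0 < k" "k \<le> L" for k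
    unfolding \<zeta>_def using that by (intro sum_powers_root_of_unity) auto
  have cnj: "cnj (\<zeta> j) * \<zeta> j = 1" for j
    using complex_norm_square[of "\<zeta> j"] by (simp add: \<zeta>_def norm_power mult.commute)
  have "(\<Sum>j<Suc L. let z = \<zeta> j in \<Sum>m<L. z ^ m * (\<alpha> m + z * \<beta> m + cnj z * \<gamma> m)) =
      (\<Sum>m<L. \<Sum>j<Suc L. \<zeta> j ^ m * (\<alpha> m + \<zeta> j * \<beta> m + cnj (\<zeta> j) * \<gamma> m))"
    unfolding Let_def by (rule sum.swap)
  also have "\<dots> = (\<Sum>m<L. of_nat (Suc L) * ((if m = 0 then \<alpha> 0 else 0) + (if m = 1 then \<gamma> 1 else 0)))"
  proof (rule sum.cong)
    fix m assume "m \<in> {..<L}"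
    then have m: "m < L" by simp
    have "(\<Sum>j<Suc L. \<zeta> j ^ m * (\<alpha> m + \<zeta> j * \<beta> m + cnj (\<zeta> j) * \<gamma> m)) =
        (\<Sum>j<Suc L. \<zeta> j ^ m) * \<alpha> m + (\<Sum>j<Suc L. \<zeta> j ^ Suc m) * \<beta> m + (\<Sum>j<Suc L. \<zeta> j ^ m * cnj (\<zeta> j)) * \<gamma> m"
      by (simp only: sum_distrib_right sum.distrib[symmetric]) (simp add: algebra_simps)
    also have "(\<Sum>j<Suc L. \<zeta> j ^ Suc m) = 0" using m by (intro S) auto
    also have "(\<Sum>j<Suc L. \<zeta> j ^ m) * \<alpha> m = of_nat (Suc L) * (if m = 0 then \<alpha> 0 else 0)"
      using m S[of m] by (cases "m = 0") auto
    also have "(\<Sum>j<Suc L. \<zeta> j ^ m * cnj (\<zeta> j)) * \<gamma> m = of_nat (Suc L) * (if m = 1 then \<gamma> 1 else 0)"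
    proof (cases m)
      case (Suc k)
      have "(\<Sum>j<Suc L. \<zeta> j ^ m * cnj (\<zeta> j)) = (\<Sum>j<Suc L. \<zeta> j ^ k * (cnj (\<zeta> j) * \<zeta> j))"
        by (simp only: Suc power_Suc ac_simps)
      also have "\<dots> = (\<Sum>j<Suc L. \<zeta> j ^ k)" unfolding cnj by simp
      finally show ?thesis using m S[of k] Suc by (cases "k = 0") auto
    qed (simp add: \<gamma>0)
    finally show "(\<Sum>j<Suc L. \<zeta> j ^ m * (\<alpha> m + \<zeta> j * \<beta> m + cnj (\<zeta> j) * \<gamma> m)) =
        of_nat (Suc L) * ((if m = 0 then \<alpha> 0 else 0) + (if m = 1 then \<gamma> 1 else 0))"
      by (simp only: distrib_left mult_zero_left add_0_right)
  qed simp
  also have "\<dots> = of_nat (Suc L) * (\<alpha> 0 + \<gamma> 1)"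
    using L by (simp only: sum_distrib_left[symmetric] sum.distrib sum.delta finite_lessThan) simp
  finally show ?thesis unfolding \<zeta>_def .
qed

text \<open>Iterating \<open>y = x + w T y\<close>. The explicit remainder avoids infinite series of
  matrices.\<close>

lemma Neumann_cip:
  assumes T: "(T :: complex mat) \<in> carrier_mat n n" and y: "y \<in> carrier_vec n" and x: "x \<in> carrier_vec n"
    and v: "v \<in> carrier_vec n" and eq: "y - w \<cdot>\<^sub>v (T *\<^sub>v y) = x"
  shows "y \<bullet>c v = (\<Sum>m<L. w ^ m * ((T ^\<^sub>m m *\<^sub>v x) \<bullet>c v)) + w ^ L * ((T ^\<^sub>m L *\<^sub>v y) \<bullet>c v)"
proof (induction L)
  case 0
  show ?case using T y by simp
next
  case (Suc L)
  have P: "T ^\<^sub>m L \<in> carrier_mat n n" using T by simp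
  have "T ^\<^sub>m L *\<^sub>v x = T ^\<^sub>m L *\<^sub>v y - w \<cdot>\<^sub>v (T ^\<^sub>m Suc L *\<^sub>v y)"
    unfolding eq[symmetric] using T y P
    by (simp add: mult_minus_distrib_mat_vec[OF P] mult_mat_vec[OF P] assoc_mult_mat_vec[OF P T y] del: assoc_mult_mat_vec)
  then have step: "(T ^\<^sub>m L *\<^sub>v x) \<bullet>c v = (T ^\<^sub>m L *\<^sub>v y) \<bullet>c v - w * ((T ^\<^sub>m Suc L *\<^sub>v y) \<bullet>c v)"
    using T P x y v by (simp add: cip_linear assoc_mult_mat_vec[OF P T y])
  show ?case unfolding Suc sum.lessThan_Suc step by (simp add: algebra_simps)
qed

section \<open>The corner entry of a dominated matrix\<close>

lemma cip_unit_vec: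
  assumes "i < n"
  shows "x \<bullet>c unit_vec n i = x $ i" "x \<in> carrier_vec n \<Longrightarrow> unit_vec n i \<bullet>c x = cnj (x $ i)"
proof -
  have "conjugate (unit_vec n i) = (unit_vec n i :: complex vec)"
    by (intro eq_vecI) (auto simp: unit_vec_def)
  then show "x \<bullet>c unit_vec n i = x $ i"
    using assms by simp
  show "x \<in> carrier_vec n \<Longrightarrow> unit_vec n i \<bullet>c x = cnj (x $ i)"
    using assms by (subst scalar_prod_left_unit) auto
qed

lemma mult_unit_vec_index:
  assumes "(A :: complex mat) \<in> carrier_mat n n" "i < n" "j < n"
  shows "(A *\<^sub>v unit_vec n j) $ i = A $$ (i, j)"
  using assms by simp


text \<open>The vector \<open>v\<close> is the resolvent of the corner matrix applied to \<open>x\<close>.\<close>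

lemma corner_test_vectors:
  assumes n: "3 \<le> n" and a: "a = 2 * u" and u: "cmod u = 1" and z: "cmod z = 1"
    and x: "x = unit_vec n (n - 1) - (u * z) \<cdot>\<^sub>v unit_vec n 0"
    and v: "v = unit_vec n (n - 1) + (complex_of_real (2 * r - 1) * u * z) \<cdot>\<^sub>v unit_vec n 0"
  shows "v - (complex_of_real r * z) \<cdot>\<^sub>v (corner_mat n a *\<^sub>v v) = x"
    and "v \<bullet>c x = complex_of_real (2 * (1 - r))"
    and "sqn x = 2"
proof -
  have v_carrier: "v \<in> carrier_vec n" by (simp add: v)
  have vn: "v $ (n - 1) = 1" using n by (simp add: v unit_vec_def)
  show "v - (complex_of_real r * z) \<cdot>\<^sub>v (corner_mat n a *\<^sub>v v) = x"
  proof (rule eq_vecI)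
    fix i assume "i < dim_vec x"
    then have i: "i < n" by (simp add: x)
    have "(corner_mat n a *\<^sub>v v) $ i = (\<Sum>j<n. (if i = 0 \<and> j = n - 1 then a else 0) * v $ j)"
      using i v_carrier by (simp add: corner_mat_def scalar_prod_def atLeast0LessThan)
    also have "\<dots> = (if i = 0 then a else 0)"
      using n vn by (subst sum.remove[of _ "n - 1"]) (auto intro!: sum.neutral)
    finally have "(corner_mat n a *\<^sub>v v) $ i = (if i = 0 then a else 0)" .
    then show "(v - (complex_of_real r * z) \<cdot>\<^sub>v (corner_mat n a *\<^sub>v v)) $ i = x $ i"
      using i n by (simp add: v x a unit_vec_def corner_mat_def algebra_simps del: index_mult_mat_vec)
  qed (simp add: x corner_mat_def)
  have uz: "u * z * (cnj u * cnj z) = 1"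
    using u z complex_norm_square[of "u * z"] by (simp add: norm_mult)
  show "v \<bullet>c x = complex_of_real (2 * (1 - r))"
    using n uz unfolding v x by (simp add: cip_linear cip_unit_vec algebra_simps)
  have "x \<bullet>c x = 2"
    using n uz unfolding x by (simp add: cip_linear cip_unit_vec algebra_simps)
  then show "sqn x = 2" by (simp add: sqn_def)
qed

lemma dominated_by_corner_entry:
  assumes n: "3 \<le> n" and a: "a = 2 * u" and u: "cmod u = 1" and T: "T \<in> C2 n"
    and dom: "harnack_dominated n T (corner_mat n a)"
  shows "2 \<le> Re (cnj u * T $$ (0, n - 1))"
proof -
  have Tc: "T \<in> carrier_mat n n" using T by (rule C2_carrier)
  have N: "corner_mat n a \<in> C2 n"
    unfolding corner_mat_eq_block using n a u
    by (intro corner_block_mat_C2 zero_mat_C2) (auto simp: norm_mult)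
  obtain c where c: "1 \<le> c" and P: "\<And>w y v. cmod w < 1 \<Longrightarrow> y \<in> carrier_vec n \<Longrightarrow> v \<in> carrier_vec n \<Longrightarrow>
       y - w \<cdot>\<^sub>v (T *\<^sub>v y) = v - w \<cdot>\<^sub>v (corner_mat n a *\<^sub>v v) \<Longrightarrow>
       Re (y \<bullet>c (y - w \<cdot>\<^sub>v (T *\<^sub>v y))) \<le> c\<^sup>2 * Re (v \<bullet>c (v - w \<cdot>\<^sub>v (corner_mat n a *\<^sub>v v)))"
    using dom unfolding harnack_dominated_iff[OF T N] by blast
  define e0 :: "complex vec" where "e0 = unit_vec n 0"
  define e1 :: "complex vec" where "e1 = unit_vec n (n - 1)"
  have e: "e0 \<in> carrier_vec n" "e1 \<in> carrier_vec n" by (auto simp: e0_def e1_def)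
  define \<rho> where "\<rho> = Re (cnj u * T $$ (0, n - 1))"
  have main: "2 - r * \<rho> \<le> 2 * c\<^sup>2 * (1 - r)" if r: "0 < r" "r < 1" for r
  proof -
    obtain g where g: "g \<longlonglongrightarrow> 0" and decay: "\<And>k x y. x \<in> carrier_vec n \<Longrightarrow> y \<in> carrier_vec n \<Longrightarrow>
        r ^ k * cmod ((T ^\<^sub>m k *\<^sub>v x) \<bullet>c y) \<le> g k * (sqrt (sqn x) * sqrt (sqn y))"
      using C2_powers_decay[OF T, of r] n r by auto
    define x where "x z = e1 - (u * z) \<cdot>\<^sub>v e0" for z
    have xc: "x z \<in> carrier_vec n" for z using e by (simp add: x_def)
    \<comment> \<open>The partial Neumann sum is the form \<open>Re (y \<bullet>c x z)\<close>,
      controlled by domination, minus the real part of a remainder whose bound does not depend on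
      \<open>z\<close>.\<close>
    have est: "Re (\<Sum>m<L. (complex_of_real r * z) ^ m * ((T ^\<^sub>m m *\<^sub>v x z) \<bullet>c x z)) \<le>
        2 * c\<^sup>2 * (1 - r) + \<bar>g L\<bar> * (2 * c)" if z: "cmod z = 1" for z L
    proof -
      let ?w = "complex_of_real r * z"
      have w: "cmod ?w = r" "cmod ?w < 1" "cmod (cnj ?w) < 1" using z r by (auto simp: norm_mult)
      obtain y where y: "y \<in> carrier_vec n" "y - ?w \<cdot>\<^sub>v (T *\<^sub>v y) = x z"
        using K2_cip[OF T w(3) xc[of z]] by (metis complex_cnj_cnj)
      \<comment> \<open>The coefficient \<open>2 * r - 1\<close> is forced: the corner contributes
        \<open>2 * r * u * z\<close>, and \<open>- u * z\<close> must remain.\<close>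
      define v where "v = e1 + (complex_of_real (2 * r - 1) * u * z) \<cdot>\<^sub>v e0"
      have vc: "v \<in> carrier_vec n" using e by (simp add: v_def)
      note tv = corner_test_vectors[OF n a u z x_def[of z, unfolded e0_def e1_def] v_def[unfolded e0_def e1_def]]
      have "Re (y \<bullet>c x z) \<le> c\<^sup>2 * Re (v \<bullet>c x z)"
        using P[OF w(2) y(1) vc] unfolding tv(1) y(2) by simp
      then have le: "Re (y \<bullet>c x z) \<le> 2 * c\<^sup>2 * (1 - r)" unfolding tv(2) by (simp add: algebra_simps)
      \<comment> \<open>Domination and coercivity both carry the factor \<open>1 - r\<close>;
        cancelling it bounds \<open>y\<close> independently of \<open>z\<close> and
        \<open>L\<close>.\<close>
      have "(1 - r) * sqn y \<le> Re (y \<bullet>c x z)"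
        using sqn_le_Re_cip_resolvent(1)[OF T y(1), of ?w] unfolding y(2) w(1) .
      with le have "(1 - r) * sqn y \<le> (1 - r) * (2 * c\<^sup>2)" by (simp add: algebra_simps)
      then have "sqn y \<le> 2 * c\<^sup>2" using r by (simp add: mult_le_cancel_left)
      then have "sqrt (sqn y) * sqrt (sqn (x z)) \<le> sqrt (2 * c\<^sup>2) * sqrt 2"
        unfolding tv(3) by (intro mult_right_mono real_sqrt_le_mono) auto
      also have "\<dots> = 2 * c" using c by (simp add: real_sqrt_mult)
      finally have "\<bar>g L\<bar> * (sqrt (sqn y) * sqrt (sqn (x z))) \<le> \<bar>g L\<bar> * (2 * c)"
        by (intro mult_left_mono) auto
      moreover have "g L * (sqrt (sqn y) * sqrt (sqn (x z))) \<le> \<bar>g L\<bar> * (sqrt (sqn y) * sqrt (sqn (x z)))"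
        by (intro mult_right_mono) auto
      moreover have "cmod (?w ^ L * ((T ^\<^sub>m L *\<^sub>v y) \<bullet>c x z)) \<le> g L * (sqrt (sqn y) * sqrt (sqn (x z)))"
        using decay[OF y(1) xc, of L z] w(1) by (simp add: norm_mult norm_power z)
      moreover have "- Re (?w ^ L * ((T ^\<^sub>m L *\<^sub>v y) \<bullet>c x z)) \<le> cmod (?w ^ L * ((T ^\<^sub>m L *\<^sub>v y) \<bullet>c x z))"
        using abs_Re_le_cmod[of "?w ^ L * ((T ^\<^sub>m L *\<^sub>v y) \<bullet>c x z)"] by linarith
      ultimately have "- Re (?w ^ L * ((T ^\<^sub>m L *\<^sub>v y) \<bullet>c x z)) \<le> \<bar>g L\<bar> * (2 * c)" by linarith
      then show ?thesis
        using le arg_cong[OF Neumann_cip[OF Tc y(1) xc xc y(2), of z L], of Re] by simp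
    qed
    \<comment> \<open>Expanding the form at \<open>x z\<close> and sorting by powers of
      \<open>z\<close>; the corner entry of \<open>T\<close> appears in
      \<open>\<gamma> 1\<close>.\<close>
    define \<alpha> where "\<alpha> m = complex_of_real r ^ m * ((T ^\<^sub>m m *\<^sub>v e1) \<bullet>c e1 + (T ^\<^sub>m m *\<^sub>v e0) \<bullet>c e0)" for m
    define \<beta> where "\<beta> m = - (complex_of_real r ^ m * u * ((T ^\<^sub>m m *\<^sub>v e0) \<bullet>c e1))" for m
    define \<gamma> where "\<gamma> m = - (complex_of_real r ^ m * cnj u * ((T ^\<^sub>m m *\<^sub>v e1) \<bullet>c e0))" for m
    have expand: "(complex_of_real r * z) ^ m * ((T ^\<^sub>m m *\<^sub>v x z) \<bullet>c x z) = z ^ m * (\<alpha> m + z * \<beta> m + cnj z * \<gamma> m)"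
      if z: "cmod z = 1" for z m
    proof -
      have Tm: "T ^\<^sub>m m \<in> carrier_mat n n" using Tc by simp
      have uz: "u * z * (cnj u * cnj z) = 1"
        using u z complex_norm_square[of "u * z"] by (simp add: norm_mult)
      have Tx: "T ^\<^sub>m m *\<^sub>v x z = T ^\<^sub>m m *\<^sub>v e1 - (u * z) \<cdot>\<^sub>v (T ^\<^sub>m m *\<^sub>v e0)"
        unfolding x_def using e by (simp add: mult_minus_distrib_mat_vec[OF Tm] mult_mat_vec[OF Tm])
      have ip: "(T ^\<^sub>m m *\<^sub>v x z) \<bullet>c x z = (T ^\<^sub>m m *\<^sub>v e1) \<bullet>c e1 - u * z * ((T ^\<^sub>m m *\<^sub>v e0) \<bullet>c e1)
          - cnj u * cnj z * ((T ^\<^sub>m m *\<^sub>v e1) \<bullet>c e0) + u * z * (cnj u * cnj z) * ((T ^\<^sub>m m *\<^sub>v e0) \<bullet>c e0)"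
        unfolding Tx unfolding x_def using e Tm Tc by (simp add: cip_linear algebra_simps)
      show ?thesis unfolding ip uz \<alpha>_def \<beta>_def \<gamma>_def power_mult_distrib
        by (simp add: algebra_simps)
    qed
    have val: "\<alpha> 0 = 2" "\<gamma> 0 = 0" "\<gamma> 1 = - (complex_of_real r * (cnj u * T $$ (0, n - 1)))"
      using n e Tc by (simp_all add: \<alpha>_def \<gamma>_def e0_def e1_def cip_unit_vec mult_unit_vec_index[OF Tc])
    have "2 - r * \<rho> \<le> 2 * c\<^sup>2 * (1 - r) + \<bar>g L\<bar> * (2 * c)" if L: "2 \<le> L" for L
    proof -
      define \<zeta> where "\<zeta> j = cis (2 * pi / real (Suc L)) ^ j" for j
      have \<zeta>: "cmod (\<zeta> j) = 1" for j by (simp add: \<zeta>_def norm_power)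
      have "(\<Sum>j<Suc L. \<Sum>m<L. (complex_of_real r * \<zeta> j) ^ m * ((T ^\<^sub>m m *\<^sub>v x (\<zeta> j)) \<bullet>c x (\<zeta> j)))
          = of_nat (Suc L) * (\<alpha> 0 + \<gamma> 1)"
        unfolding expand[OF \<zeta>] using average_trig_poly[of \<gamma>, OF val(2) L, of \<alpha> \<beta>]
        by (simp only: Let_def \<zeta>_def)
      then have "real (Suc L) * (2 - r * \<rho>) =
          (\<Sum>j<Suc L. Re (\<Sum>m<L. (complex_of_real r * \<zeta> j) ^ m * ((T ^\<^sub>m m *\<^sub>v x (\<zeta> j)) \<bullet>c x (\<zeta> j))))"
        unfolding val \<rho>_def Re_sum[symmetric] by simp
      also have "\<dots> \<le> (\<Sum>j<Suc L. 2 * c\<^sup>2 * (1 - r) + \<bar>g L\<bar> * (2 * c))"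
        by (intro sum_mono est \<zeta>)
      also have "\<dots> = real (Suc L) * (2 * c\<^sup>2 * (1 - r) + \<bar>g L\<bar> * (2 * c))" by simp
      finally show ?thesis by (subst (asm) mult_le_cancel_left_pos) auto
    qed
    moreover have "(\<lambda>L. 2 * c\<^sup>2 * (1 - r) + \<bar>g L\<bar> * (2 * c)) \<longlonglongrightarrow> 2 * c\<^sup>2 * (1 - r) + \<bar>0\<bar> * (2 * c)"
      by (intro tendsto_intros g)
    ultimately have "2 - r * \<rho> \<le> 2 * c\<^sup>2 * (1 - r) + \<bar>0\<bar> * (2 * c)"
      by (intro LIMSEQ_le_const) auto
    then show ?thesis by simp
  qed
  have "2 \<le> \<rho>"
  proof (rule ccontr)
    assume "\<not> 2 \<le> \<rho>"
    define d where "d = 2 - \<rho>"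
    \<comment> \<open>\<open>K\<close> dominates both \<open>d\<close> and the slope
      \<open>2 * c\<^sup>2 - \<rho>\<close>, so \<open>t\<close> lies in the unit interval and
      \<open>t * K = d / 2\<close> contradicts \<open>d \<le> t * K\<close>.\<close>
    define K where "K = 2 * c\<^sup>2 + \<bar>\<rho>\<bar> + d"
    define t where "t = d / (2 * K)"
    have d: "0 < d" using \<open>\<not> 2 \<le> \<rho>\<close> by (simp add: d_def)
    have K: "d \<le> K" "2 * c\<^sup>2 - \<rho> \<le> K" using d by (auto simp: K_def)
    have t: "0 < t" "t < 1" "t * K = d / 2" using d K by (auto simp: t_def field_simps)
    have "2 - (1 - t) * \<rho> \<le> 2 * c\<^sup>2 * t" using main[of "1 - t"] t by simp
    then have "d \<le> t * (2 * c\<^sup>2 - \<rho>)" by (simp add: d_def algebra_simps)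
    also have "\<dots> \<le> t * K" using K t by (intro mult_left_mono) auto
    finally show False using t d by simp
  qed
  then show ?thesis by (simp add: \<rho>_def)
qed

section \<open>Rigidity and the middle block\<close>

text \<open>The conclusion says that \<open>y\<close> lies in the kernel of the positive
  semidefinite matrix \<open>2 I - w T - (w T)^*\<close>, tested against \<open>v\<close>.\<close>

lemma C2_attained_imp_kernel:
  assumes T: "T \<in> C2 n" and w: "cmod w = 1" and y: "y \<in> carrier_vec n" and v: "v \<in> carrier_vec n"
    and att: "sqn y \<le> Re (w * ((T *\<^sub>v y) \<bullet>c y))"
  shows "2 * (y \<bullet>c v) = w * ((T *\<^sub>v y) \<bullet>c v) + cnj w * (y \<bullet>c (T *\<^sub>v v))"
proof -
  have Tc: "T \<in> carrier_mat n n" using T by (rule C2_carrier)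
  \<comment> \<open>\<open>y\<close> minimises \<open>\<parallel>y\<parallel>\<^sup>2 - Re (w \<langle>T y, y\<rangle>)\<close>, whose derivative at \<open>y\<close> in direction \<open>t v\<close> is \<open>Re (cnj t E)\<close>.\<close>
  define E where "E = 2 * (y \<bullet>c v) - w * ((T *\<^sub>v y) \<bullet>c v) - cnj w * (y \<bullet>c (T *\<^sub>v v))"
  define q where "q = sqn v - Re (w * ((T *\<^sub>v v) \<bullet>c v))"
  have q: "0 \<le> q" using C2_Re_cip_le[OF T v, of w] w by (simp add: q_def)
  \<comment> \<open>This step length gives \<open>s * q - 1 = - s\<close>, so the increment along
    \<open>t v\<close> is minus the square of \<open>s * cmod E\<close>, which forces
    \<open>E = 0\<close>.\<close>
  define s where "s = 1 / (q + 1)"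
  define t where "t = - complex_of_real s * E"
  have Tyt: "T *\<^sub>v (y + t \<cdot>\<^sub>v v) = T *\<^sub>v y + t \<cdot>\<^sub>v (T *\<^sub>v v)"
    using y v by (simp add: mult_add_distrib_mat_vec[OF Tc] mult_mat_vec[OF Tc])
  have tt: "t * cnj t = complex_of_real ((cmod t)\<^sup>2)" using complex_norm_square[of t] by simp
  have "(T *\<^sub>v (y + t \<cdot>\<^sub>v v)) \<bullet>c (y + t \<cdot>\<^sub>v v) = (T *\<^sub>v y) \<bullet>c y + cnj t * ((T *\<^sub>v y) \<bullet>c v)
      + t * ((T *\<^sub>v v) \<bullet>c y) + t * cnj t * ((T *\<^sub>v v) \<bullet>c v)"
    unfolding Tyt using Tc y v by (simp add: cip_linear algebra_simps)
  then have "Re (w * ((T *\<^sub>v (y + t \<cdot>\<^sub>v v)) \<bullet>c (y + t \<cdot>\<^sub>v v))) = Re (w * ((T *\<^sub>v y) \<bullet>c y))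
      + Re (cnj t * (w * ((T *\<^sub>v y) \<bullet>c v))) + Re (cnj (cnj t * (cnj w * (y \<bullet>c (T *\<^sub>v v)))))
      + (cmod t)\<^sup>2 * Re (w * ((T *\<^sub>v v) \<bullet>c v))"
    unfolding tt using cip_swap[of y "T *\<^sub>v v"] Tc y v by (simp add: algebra_simps)
  moreover have "sqn (y + t \<cdot>\<^sub>v v) = sqn y + (cmod t)\<^sup>2 * sqn v + 2 * Re (cnj t * (y \<bullet>c v))"
    using y v by (subst sqn_add) (simp_all add: sqn_smult cip_linear)
  moreover have "Re (w * ((T *\<^sub>v (y + t \<cdot>\<^sub>v v)) \<bullet>c (y + t \<cdot>\<^sub>v v))) \<le> sqn (y + t \<cdot>\<^sub>v v)"
    using C2_Re_cip_le[OF T, of "y + t \<cdot>\<^sub>v v" w] w y v by simp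
  ultimately have "0 \<le> Re (cnj t * E) + (cmod t)\<^sup>2 * q"
    using att unfolding E_def q_def complex_cnj(1)
    by (simp add: algebra_simps)
  moreover have "Re (cnj t * E) = - (s * (cmod E)\<^sup>2)"
    unfolding cmod_power2 by (simp add: t_def algebra_simps power2_eq_square)
  moreover have "(cmod t)\<^sup>2 = s * (s * (cmod E)\<^sup>2)"
    by (simp add: t_def norm_mult power_mult_distrib power2_eq_square)
  ultimately have "0 \<le> - (s * (cmod E)\<^sup>2) + s * (s * (cmod E)\<^sup>2) * q"
    by (simp only:)
  then have "0 \<le> s * (cmod E)\<^sup>2 * (s * q - 1)"
    by (simp add: algebra_simps)
  also have "s * q - 1 = - s" using q by (simp add: s_def field_simps)
  finally have "(s * cmod E)\<^sup>2 \<le> 0" by (simp add: power2_eq_square algebra_simps)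
  then have "E = 0" using q by (simp add: s_def)
  then show ?thesis by (simp add: E_def algebra_simps)
qed

lemma C2_corner_entry_rigid:
  assumes n: "3 \<le> n" and u: "cmod u = 1" and T: "T \<in> C2 n" and corner: "2 \<le> Re (cnj u * T $$ (0, n - 1))"
    and k: "k < n"
  shows "T $$ (k, 0) = 0" and "T $$ (n - 1, k) = 0"
    and "T $$ (k, n - 1) = (if k = 0 then 2 * u else 0)"
    and "T $$ (0, k) = (if k = n - 1 then 2 * u else 0)"
proof -
  have Tc: "T \<in> carrier_mat n n" using T by (rule C2_carrier)
  define e0 :: "complex vec" where "e0 = unit_vec n 0"
  define e1 :: "complex vec" where "e1 = unit_vec n (n - 1)"
  have e: "e0 \<in> carrier_vec n" "e1 \<in> carrier_vec n" by (auto simp: e0_def e1_def)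
  have uu: "u * cnj u = 1" using complex_norm_square[of u] u by simp
  define y where "y w = e1 + (u * w) \<cdot>\<^sub>v e0" for w
  have yc: "y w \<in> carrier_vec n" for w using e by (simp add: y_def)
  have Ty: "T *\<^sub>v y w = T *\<^sub>v e1 + (u * w) \<cdot>\<^sub>v (T *\<^sub>v e0)" for w
    unfolding y_def using e by (simp add: mult_add_distrib_mat_vec[OF Tc] mult_mat_vec[OF Tc])
  define q where "q w = sqn (y w) - Re (w * ((T *\<^sub>v y w) \<bullet>c y w))" for w
  have q_nonneg: "0 \<le> q w" if "cmod w = 1" for w
    using C2_Re_cip_le[OF T yc, of w w] that by (simp add: q_def)
  define p where "p = (T *\<^sub>v e1) \<bullet>c e1 + (T *\<^sub>v e0) \<bullet>c e0"
  define \<beta> where "\<beta> = u * ((T *\<^sub>v e0) \<bullet>c e1)"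
  define \<gamma> where "\<gamma> = cnj u * T $$ (0, n - 1)"
  have q: "q w = 2 - Re (w * p + \<gamma> + w * w * \<beta>)" if w: "cmod w = 1" for w
  proof -
    have ww: "w * cnj w = 1" using complex_norm_square[of w] w by simp
    have "y w \<bullet>c y w = 1 + u * cnj u * (w * cnj w)"
      unfolding y_def e0_def e1_def using n by (simp add: cip_linear cip_unit_vec algebra_simps)
    then have "sqn (y w) = 2" unfolding uu ww sqn_def by simp
    moreover have "w * ((T *\<^sub>v y w) \<bullet>c y w) = w * ((T *\<^sub>v e1) \<bullet>c e1 + u * cnj u * (w * cnj w) * ((T *\<^sub>v e0) \<bullet>c e0))
        + cnj u * (w * cnj w) * ((T *\<^sub>v e1) \<bullet>c e0) + w * w * u * ((T *\<^sub>v e0) \<bullet>c e1)"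
      unfolding Ty unfolding y_def using Tc e by (simp add: cip_linear algebra_simps)
    moreover have "(T *\<^sub>v e1) \<bullet>c e0 = T $$ (0, n - 1)"
      using n unfolding e0_def e1_def by (simp add: cip_unit_vec mult_unit_vec_index[OF Tc] del: index_mult_mat_vec)
    ultimately show ?thesis
      unfolding uu ww q_def p_def \<beta>_def \<gamma>_def by (simp add: algebra_simps)
  qed
  \<comment> \<open>Over the fourth roots of unity both \<open>w\<close> and \<open>w * w\<close>
    sum to 0, which removes \<open>p\<close> and \<beta>.\<close>
  have "q 1 + q (-1) + q \<i> + q (-\<i>) = 8 - 4 * Re \<gamma>" by (simp add: q)
  then have "q 1 + q (-1) + q \<i> + q (-\<i>) \<le> 0" using corner by (simp add: \<gamma>_def)
  moreover have "0 \<le> q 1" "0 \<le> q (-1)" "0 \<le> q \<i>" "0 \<le> q (-\<i>)" by (auto intro: q_nonneg)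
  ultimately have q0: "q 1 \<le> 0" "q (-1) \<le> 0" "q \<i> \<le> 0" "q (-\<i>) \<le> 0" by linarith+
  have rel: "(T *\<^sub>v e0) \<bullet>c v = 0 \<and> e1 \<bullet>c (T *\<^sub>v v) = 0 \<and> (T *\<^sub>v e1) \<bullet>c v = 2 * u * (e0 \<bullet>c v)
      \<and> u * (e0 \<bullet>c (T *\<^sub>v v)) = 2 * (e1 \<bullet>c v)" if v: "v \<in> carrier_vec n" for v
  proof -
    \<comment> \<open>The kernel condition at \<open>y w\<close> is a trigonometric polynomial in
      \<open>w\<close>; \<open>A\<close>, \<open>B\<close>, \<open>C\<close>, \<open>D\<close> are,
      up to sign, its coefficients at \<open>1\<close>, \<open>w\<close>, \<open>w * w\<close>,
      \<open>cnj w\<close>.\<close>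
    define A where "A = 2 * (e1 \<bullet>c v) - u * (e0 \<bullet>c (T *\<^sub>v v))"
    define B where "B = 2 * u * (e0 \<bullet>c v) - (T *\<^sub>v e1) \<bullet>c v"
    define C where "C = u * ((T *\<^sub>v e0) \<bullet>c v)"
    define D where "D = e1 \<bullet>c (T *\<^sub>v v)"
    have eq: "A + w * B - w * w * C - cnj w * D = 0" if w: "cmod w = 1" "q w \<le> 0" for w
    proof -
      have ww: "w * cnj w = 1" using complex_norm_square[of w] w by simp
      have "2 * (y w \<bullet>c v) = w * ((T *\<^sub>v y w) \<bullet>c v) + cnj w * (y w \<bullet>c (T *\<^sub>v v))"
        using w by (intro C2_attained_imp_kernel[OF T w(1) yc v]) (simp add: q_def)
      then have "2 * (e1 \<bullet>c v) + 2 * u * w * (e0 \<bullet>c v) = w * ((T *\<^sub>v e1) \<bullet>c v) + w * w * u * ((T *\<^sub>v e0) \<bullet>c v)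
          + cnj w * (e1 \<bullet>c (T *\<^sub>v v)) + u * (w * cnj w) * (e0 \<bullet>c (T *\<^sub>v v))"
        unfolding Ty unfolding y_def using Tc e v by (simp add: cip_linear algebra_simps)
      then show ?thesis unfolding ww A_def B_def C_def D_def by (simp add: algebra_simps)
    qed
    have h: "A + B - C - D = 0" "A - B - C + D = 0" "A + \<i> * B + C + \<i> * D = 0" "A - \<i> * B + C - \<i> * D = 0"
      using eq[of 1] eq[of "-1"] eq[of \<i>] eq[of "-\<i>"] q0 by simp_all
    \<comment> \<open>Inverting the four-point discrete Fourier transform separates the
      coefficients.\<close>
    have "2 * (A - C) = (A + B - C - D) + (A - B - C + D)"
      "2 * (B - D) = (A + B - C - D) - (A - B - C + D)"
      "2 * (A + C) = (A + \<i> * B + C + \<i> * D) + (A - \<i> * B + C - \<i> * D)"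
      "2 * (\<i> * (B + D)) = (A + \<i> * B + C + \<i> * D) - (A - \<i> * B + C - \<i> * D)"
      by (simp_all add: algebra_simps)
    then have "A = C" "B = D" "A + C = 0" "B + D = 0" unfolding h by simp_all
    then have "A = 0" "B = 0" "C = 0" "D = 0" by simp_all
    then show ?thesis using u by (auto simp: A_def B_def C_def D_def)
  qed
  have u0: "u \<noteq> 0" using u by auto
  let ?e = "unit_vec n k :: complex vec"
  have kc: "?e \<in> carrier_vec n" and Tk: "T *\<^sub>v ?e \<in> carrier_vec n" using Tc by auto
  note r = rel[OF kc]
  show "T $$ (k, 0) = 0"
    using r n k unfolding e0_def by (simp add: cip_unit_vec mult_unit_vec_index[OF Tc] del: index_mult_mat_vec)
  show "T $$ (n - 1, k) = 0"
    using r n k unfolding e1_def by (simp add: cip_unit_vec(2)[OF _ Tk] mult_unit_vec_index[OF Tc] del: index_mult_mat_vec)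
  show "T $$ (k, n - 1) = (if k = 0 then 2 * u else 0)"
    using r n k unfolding e0_def e1_def
    by (simp add: cip_unit_vec(1) mult_unit_vec_index[OF Tc] del: index_mult_mat_vec)
  have "u * cnj (T $$ (0, k)) = (if k = n - 1 then 2 else 0)"
    using r n k unfolding e0_def e1_def
    by (simp add: cip_unit_vec(1) cip_unit_vec(2)[OF _ Tk] mult_unit_vec_index[OF Tc] del: index_mult_mat_vec)
  then have "cnj (u * cnj (T $$ (0, k))) * u = (if k = n - 1 then 2 * u else 0)" by simp
  moreover have "cnj (u * cnj (T $$ (0, k))) * u = (u * cnj u) * T $$ (0, k)" by simp
  ultimately show "T $$ (0, k) = (if k = n - 1 then 2 * u else 0)" unfolding uu by simp
qed

lemma C2_corner_entry_imp_block:
  assumes n: "3 \<le> n" and u: "cmod u = 1" and T: "T \<in> C2 n" and corner: "2 \<le> Re (cnj u * T $$ (0, n - 1))"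
  shows "T = corner_block_mat n (2 * u) (mat (n - 2) (n - 2) (\<lambda>(i, j). T $$ (Suc i, Suc j)))"
    (is "T = ?R")
proof (rule eq_matI)
  note rigid = C2_corner_entry_rigid[OF n u T corner]
  fix i j assume "i < dim_row ?R" "j < dim_col ?R"
  then have ij: "i < n" "j < n" by (simp_all add: corner_block_mat_def)
  consider "i = 0" | "i = n - 1" "i \<noteq> 0" | "j = 0" "0 < i" "i < n - 1" | "j = n - 1" "0 < i" "i < n - 1"
    | "0 < i" "i < n - 1" "0 < j" "j < n - 1"
    using ij by linarith
  then show "T $$ (i, j) = ?R $$ (i, j)"
    using ij n rigid[OF ij(1)] rigid[OF ij(2)] by cases (auto simp: corner_block_mat_def)
qed (use C2_carrier[OF T] in \<open>simp_all add: corner_block_mat_def\<close>)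

section \<open>Strict bound for the numerical radius of the middle block\<close>

lemma equivalent_imp_numerical_radius_less:
  assumes n: "3 \<le> n" and a: "cmod a = 2" and B: "B \<in> C2 (n - 2)"
    and dom: "harnack_dominated n (corner_block_mat n a B) (corner_mat n a)"
      "harnack_dominated n (corner_mat n a) (corner_block_mat n a B)"
  shows "numerical_radius B < 1"
proof -
  let ?T = "corner_block_mat n a B" and ?N = "corner_mat n a" and ?e = "embed_vec n"
  have Bc: "B \<in> carrier_mat (n - 2) (n - 2)" using B by (rule C2_carrier)
  have T: "?T \<in> C2 n" using n a B by (rule corner_block_mat_C2)
  have N: "?N \<in> C2 n"
    unfolding corner_mat_eq_block using n a by (intro corner_block_mat_C2 zero_mat_C2) auto
  define d where "d w y = y - w \<cdot>\<^sub>v (B *\<^sub>v y)" for w y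
  have dc: "d w y \<in> carrier_vec (n - 2)" if "y \<in> carrier_vec (n - 2)" for w y
    using that Bc by (auto simp: d_def)
  have embed_block: "?e y - w \<cdot>\<^sub>v (corner_block_mat n a A *\<^sub>v ?e y) = ?e (y - w \<cdot>\<^sub>v (A *\<^sub>v y))"
    if A: "A \<in> carrier_mat (n - 2) (n - 2)" and y: "y \<in> carrier_vec (n - 2)" for A y w
  proof -
    have "corner_block_mat n a A *\<^sub>v ?e y = ?e (A *\<^sub>v y)"
    proof (rule eq_vecI)
      fix i assume "i < dim_vec (?e (A *\<^sub>v y))"
      then have i: "i < n" by simp
      note m = corner_block_mult_vec[OF n A embed_vec_carrier, of a y, unfolded middle_embed_vec[OF y] embed_vec_ends[OF n]]
      consider "i = 0" | "i = n - 1" | k where "i = Suc k" "k < n - 2" using i n by (cases i) fastforce+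
      then show "(corner_block_mat n a A *\<^sub>v ?e y) $ i = ?e (A *\<^sub>v y) $ i"
      proof cases
        case 3
        have "(corner_block_mat n a A *\<^sub>v ?e y) $ Suc k = middle_vec n (corner_block_mat n a A *\<^sub>v ?e y) $ k"
          using 3 by (simp add: middle_vec_def del: index_mult_mat_vec)
        also have "\<dots> = (A *\<^sub>v y) $ k" by (simp only: m)
        finally show ?thesis using 3 by (simp add: embed_vec_def del: index_mult_mat_vec)
      qed (use m embed_vec_ends[OF n, of "A *\<^sub>v y"] in \<open>simp_all del: index_mult_mat_vec One_nat_def\<close>)
    qed (simp add: corner_block_mat_def)
    then show ?thesis using A y by (intro eq_vecI) (auto simp: embed_vec_def simp del: index_mult_mat_vec)
  qed
  \<comment> \<open>On embedded middle vectors the corner matrix acts as 0, so its resolvent is the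
    identity there.\<close>
  have zero: "?e y - w \<cdot>\<^sub>v (?N *\<^sub>v ?e y) = ?e y" if y: "y \<in> carrier_vec (n - 2)" for y w
  proof -
    have "y - w \<cdot>\<^sub>v (0\<^sub>m (n - 2) (n - 2) *\<^sub>v y) = y" using y by (intro eq_vecI) auto
    then show ?thesis unfolding corner_mat_eq_block using embed_block[OF zero_carrier_mat y, of w] by simp
  qed
  have cip: "?e y \<bullet>c ?e z = y \<bullet>c z" if "y \<in> carrier_vec (n - 2)" "z \<in> carrier_vec (n - 2)" for y z
    using cip_split_ends[OF n embed_vec_carrier] n that
    by (simp add: middle_embed_vec embed_vec_ends del: One_nat_def)
  obtain c where c: "1 \<le> c" and dTN: "\<And>w y v. cmod w < 1 \<Longrightarrow> y \<in> carrier_vec n \<Longrightarrow> v \<in> carrier_vec n \<Longrightarrow>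
       y - w \<cdot>\<^sub>v (?T *\<^sub>v y) = v - w \<cdot>\<^sub>v (?N *\<^sub>v v) \<Longrightarrow>
       Re (y \<bullet>c (y - w \<cdot>\<^sub>v (?T *\<^sub>v y))) \<le> c\<^sup>2 * Re (v \<bullet>c (v - w \<cdot>\<^sub>v (?N *\<^sub>v v)))"
    using dom(1) unfolding harnack_dominated_iff[OF T N] by blast
  obtain c' where dNT: "\<And>w y v. cmod w < 1 \<Longrightarrow> y \<in> carrier_vec n \<Longrightarrow> v \<in> carrier_vec n \<Longrightarrow>
       y - w \<cdot>\<^sub>v (?N *\<^sub>v y) = v - w \<cdot>\<^sub>v (?T *\<^sub>v v) \<Longrightarrow>
       Re (y \<bullet>c (y - w \<cdot>\<^sub>v (?N *\<^sub>v y))) \<le> c'\<^sup>2 * Re (v \<bullet>c (v - w \<cdot>\<^sub>v (?T *\<^sub>v v)))"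
    using dom(2) unfolding harnack_dominated_iff[OF N T] by blast
  \<comment> \<open>\<open>?e y\<close> and \<open>?e (d w y)\<close> solve the two resolvent
    equations with a common right-hand side, so the dominations become inequalities about
    \<open>B\<close> alone.\<close>
  have upper: "Re (y \<bullet>c d w y) \<le> c\<^sup>2 * sqn (d w y)"
    and lower: "sqn (d w y) \<le> c'\<^sup>2 * Re (y \<bullet>c d w y)"
    if w: "cmod w < 1" and y: "y \<in> carrier_vec (n - 2)" for w y
    using dTN[OF w, of "?e y" "?e (d w y)"] dNT[OF w, of "?e (d w y)" "?e y"]
    unfolding embed_block[OF Bc y] zero[OF dc[OF y]] d_def[symmetric]
    by (simp_all add: cip dc y sqn_def)
  \<comment> \<open>\<open>K\<close> is the constant in the later bound
    \<open>sqn ?dr \<le> t\<^sup>2 * K\<close>; \<open>t\<close> is chosen with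
    \<open>c\<^sup>2 * K * t = 1 / 2\<close>, so that the closing estimate reads
    \<open>t \<le> t / 2\<close>.\<close>
  define K where "K = 2 + 4 * c'\<^sup>2"
  define t where "t = 1 / (2 * c\<^sup>2 * K)"
  have K: "2 \<le> K" by (simp add: K_def)
  have "1 \<le> c\<^sup>2" using c by simp
  then have "1 * 2 \<le> c\<^sup>2 * K" using K by (intro mult_mono) auto
  then have t: "0 < t" "t < 1" "c\<^sup>2 * K * t = 1 / 2"
    using K by (auto simp: t_def field_simps)
  have "numerical_radius B \<le> 1 - t\<^sup>2"
  proof (rule numerical_radius_le[OF Bc])
    fix y assume y: "y \<in> carrier_vec (n - 2)" and y1: "sqn y = 1"
    let ?b = "(B *\<^sub>v y) \<bullet>c y"
    show "cmod ?b \<le> 1 - t\<^sup>2"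
    proof (rule ccontr)
      assume "\<not> cmod ?b \<le> 1 - t\<^sup>2"
      then have b: "1 - t\<^sup>2 \<le> cmod ?b" by simp
      have b1: "cmod ?b \<le> 1" using C2_cmod_cip_le[OF B y] y1 by simp
      have "t\<^sup>2 < 1" using t by (simp add: power_less_one_iff abs_square_less_1)
      then have b0: "?b \<noteq> 0" using b by auto
      \<comment> \<open>The rotation that makes \<open>w0 * ?b\<close> positive, so that the form is
        smallest along this ray.\<close>
      define w0 where "w0 = cnj ?b / complex_of_real (cmod ?b)"
      have w0: "cmod w0 = 1" using b0 by (simp add: w0_def norm_divide)
      have w0b: "w0 * ?b = complex_of_real (cmod ?b)"
        using b0 complex_norm_square[of ?b] by (simp add: w0_def field_simps power2_eq_square)
      have Re_d: "Re (y \<bullet>c d (complex_of_real r * w0) y) = 1 - r * cmod ?b" for r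
        unfolding d_def sqn_le_Re_cip_resolvent(2)[OF B y] y1 by (simp add: mult.assoc w0b)
      let ?r = "1 - t" and ?s = "1 - t\<^sup>2"
      let ?dr = "d (complex_of_real ?r * w0) y" and ?ds = "d (complex_of_real ?s * w0) y"
      have s: "0 \<le> ?s" "?s < 1" using t \<open>t\<^sup>2 < 1\<close> by auto
      have "sqn ?ds \<le> c'\<^sup>2 * (1 - ?s * cmod ?b)"
        using lower[OF _ y, of "complex_of_real ?s * w0"] s w0 unfolding Re_d by (simp add: norm_mult del: of_real_diff)
      also have "\<dots> \<le> c'\<^sup>2 * (2 * t\<^sup>2)"
      proof (rule mult_left_mono)
        have "?s * ?s \<le> ?s * cmod ?b" using b s by (intro mult_left_mono) auto
        then show "1 - ?s * cmod ?b \<le> 2 * t\<^sup>2" using zero_le_power2[of "t\<^sup>2"] by (simp add: algebra_simps power2_eq_square)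
      qed simp
      finally have ds: "sqn ?ds \<le> c'\<^sup>2 * (2 * t\<^sup>2)" .
      \<comment> \<open>From \<open>(1 + t) * (1 - t) = 1 - t\<^sup>2\<close>: this carries
        smallness from the radius \<open>?s\<close> inward to \<open>?r\<close>.\<close>
      have "complex_of_real (1 + t) \<cdot>\<^sub>v ?dr = complex_of_real t \<cdot>\<^sub>v y + ?ds"
        unfolding d_def using y Bc
        by (intro eq_vecI) (auto simp: algebra_simps power2_eq_square simp del: index_mult_mat_vec)
      then have "(1 + t)\<^sup>2 * sqn ?dr = sqn (complex_of_real t \<cdot>\<^sub>v y + ?ds)"
        using sqn_smult[of "complex_of_real (1 + t)" ?dr] by (simp add: norm_of_real del: of_real_add)
      also have "\<dots> \<le> 2 * sqn (complex_of_real t \<cdot>\<^sub>v y) + 2 * sqn ?ds"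
        using dc[OF y] y by (intro sqn_add_le) (metis carrier_vecD smult_carrier_vec)
      also have "\<dots> \<le> t\<^sup>2 * K" using ds by (simp add: sqn_smult y1 K_def algebra_simps)
      finally have "(1 + t)\<^sup>2 * sqn ?dr \<le> t\<^sup>2 * K" .
      moreover have "1 * sqn ?dr \<le> (1 + t)\<^sup>2 * sqn ?dr"
        using t by (intro mult_right_mono) auto
      ultimately have dr: "sqn ?dr \<le> t\<^sup>2 * K" by linarith
      have "?r * cmod ?b \<le> ?r * 1" using b1 t by (intro mult_left_mono) auto
      then have "t \<le> 1 - ?r * cmod ?b" by simp
      also have "\<dots> \<le> c\<^sup>2 * sqn ?dr"
        using upper[OF _ y, of "complex_of_real ?r * w0"] t w0 unfolding Re_d by (simp add: norm_mult del: of_real_diff)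
      also have "\<dots> \<le> c\<^sup>2 * (t\<^sup>2 * K)" using dr by (intro mult_left_mono) auto
      also have "\<dots> = t * (c\<^sup>2 * K * t)" by (simp add: power2_eq_square algebra_simps)
      also have "\<dots> = t / 2" unfolding t(3) by simp
      finally show False using t by simp
    qed
  qed (use n in simp)
  then show ?thesis using t zero_less_power[of t 2] by linarith
qed

section \<open>The Harnack part of the corner matrix\<close>

theorem theorem3p2:
  fixes n :: nat and a :: complex
  assumes "n \<ge> 3" and "cmod a = 2"
  shows "harnack_part n (corner_mat n a) =
    {T \<in> C2 n. \<exists>B \<in> C2 (n - 2). numerical_radius B < 1 \<and> T = corner_block_mat n a B}"
proof (rule equalityI; rule subsetI)
  note n = assms(1) and a = assms(2)
  define u where "u = a / 2"
  have u: "cmod u = 1" "a = 2 * u" using a by (simp_all add: u_def norm_divide)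
  fix T assume "T \<in> harnack_part n (corner_mat n a)"
  then have T: "T \<in> C2 n" and dom: "harnack_dominated n (corner_mat n a) T" "harnack_dominated n T (corner_mat n a)"
    by (auto simp: harnack_part_def harnack_equivalence_def)
  define B where "B = mat (n - 2) (n - 2) (\<lambda>(i, j). T $$ (Suc i, Suc j))"
  have TB: "T = corner_block_mat n a B"
    using C2_corner_entry_imp_block[OF n u(1) T dominated_by_corner_entry[OF n u(2,1) T dom(2)]]
    unfolding B_def u(2)[symmetric] .
  have B: "B \<in> C2 (n - 2)"
  proof (rule corner_block_imp_C2[OF n])
    show "B \<in> carrier_mat (n - 2) (n - 2)" by (simp add: B_def)
    show "corner_block_mat n a B \<in> C2 n" using T unfolding TB[symmetric] .
  qed
  have "numerical_radius B < 1"
    using dom by (intro equivalent_imp_numerical_radius_less[OF n a B]) (simp_all only: TB[symmetric])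
  with T TB B show "T \<in> {T \<in> C2 n. \<exists>B \<in> C2 (n - 2). numerical_radius B < 1 \<and> T = corner_block_mat n a B}"
    by blast
next
  note n = assms(1) and a = assms(2)
  fix T assume "T \<in> {T \<in> C2 n. \<exists>B \<in> C2 (n - 2). numerical_radius B < 1 \<and> T = corner_block_mat n a B}"
  then obtain B where B: "B \<in> C2 (n - 2)" "numerical_radius B < 1" and T: "T = corner_block_mat n a B" by blast
  \<comment> \<open>The corner matrix is the block matrix with middle block 0, so the domination
    lemma applies in both directions.\<close>
  have z: "0\<^sub>m (n - 2) (n - 2) \<in> C2 (n - 2)" "numerical_radius (0\<^sub>m (n - 2) (n - 2)) < 1"
    using n by (simp_all add: zero_mat_C2)
  show "T \<in> harnack_part n (corner_mat n a)"
    unfolding T corner_mat_eq_block harnack_part_def harnack_equivalence_def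
    using corner_block_mat_dominated[OF n a B z] corner_block_mat_dominated[OF n a z B]
      corner_block_mat_C2[OF n a B(1)] corner_block_mat_C2[OF n a z(1)]
    by simp
qed

end
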